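(* Let $(\Sigma,\sigma)$ be a mixing shift of finite type with $K\times K$ adjacency matrix $A$, and assume that there is an order embedding of $K_0(S(\Sigma,\sigma,P))$ in $\mathbb R^k$ (with the simplicial order) with dense image, for some $k$. Then the ring $K_0(C(H,\alpha))$ is isomorphic to $\mathrm{End}_c(K_0(S(\Sigma,\sigma,P)))$, the ring of continuous endomorphisms of the dimension group $K_0(S(\Sigma,\sigma,P))$.
   Context: $A$ is a primitive $K\times K$ matrix with non-negative integer entries, $(\Sigma,\sigma)$ the associated edge shift (bi-infinite paths in the graph with $A_{ij}$ edges from vertex $i$ to vertex $j$, with the left shift), and $P\subset\Sigma$ a finite non-empty $\sigma$-invariant set. $S(\Sigma,\sigma,P)$ is the AF groupoid $C^*$-algebra of the relation "$x_n=y_n$ for all large $n$" on the set of points that agree with some $p\in P$ for all sufficiently negative $n$. Its ordered $K_0$-group, the dimension group of $A$, is the inductive limit of $\mathbb Z^K\to\mathbb Z^K\to\cdots$ (row vectors, maps $v\mapsto vA$, simplicial order at each stage); $[v,N]$ denotes the class of $v$ in the $N$th group, and $[v,N]\ge0$ iff $vA^m$ has non-negative entries for some $m\ge0$. $H=H(\Sigma,\sigma)$ is the groupoid $C^*$-algebra of the homoclinic relation ($x_n=y_n$ for all but finitely many $n$), $\alpha(f)(x,y)=f(\sigma^{-1}x,\sigma^{-1}y)$, and $C(H,\alpha)=\{f:\mathbb R\to H\text{ continuous}:f(t+1)=\alpha(f(t))\}$. The ring $K_0(C(H,\alpha))$ has its product induced by the asymptotic morphism $f\otimes g\mapsto\alpha_t(f)\alpha_{-t}(g)$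 ($t\to+\infty$), where $\alpha_t(f)(s)=f(s+t)$. In explicit terms it is the inductive limit of $C(A)\to C(A)\to\cdots$ with maps $X\mapsto AXA$, where $C(A)=\{X\in M_K(\mathbb Z):AX=XA\}$, with elements $[X,N]$ and product $[X,N]\ast[Y,M]=[XY,N+M]$. An order embedding of an ordered group $G$ in $\mathbb R^k$ with the simplicial (coordinatewise) order is an injective homomorphism $\theta:G\to\mathbb R^k$ such that $g\ge0$ iff $\theta(g)$ has non-negative coordinates. An endomorphism of $G$ (as an abelian group) is continuous if it is continuous for the topology $G$ inherits from $\mathbb R^k$ through such an embedding with dense image. *)

theory Defs
  imports "HOL-Analysis.Analysis" "HOL-Algebra.QuotRing"
begin

section \<open>Edge shifts of primitive matrices\<close>

definition primitive_matrix :: "int ^ 'n ^ 'n \<Rightarrow> bool" where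
  "primitive_matrix A \<longleftrightarrow>
     (\<forall>i j. 0 \<le> A $ i $ j) \<and>
     (\<exists>m\<ge>1. \<forall>i j. 0 < (((\<lambda>B. B ** A) ^^ m) (mat 1)) $ i $ j)"

text \<open>The triple \<open>(i, j, k)\<close> with \<open>k < A\<^sub>i\<^sub>j\<close> is the \<open>k\<close>-th edge from vertex \<open>i\<close> to vertex \<open>j\<close>.\<close>

type_synonym 'n edge = "'n \<times> 'n \<times> nat"

definition edges :: "int ^ 'n ^ 'n \<Rightarrow> 'n edge set" where
  "edges A = {(i, j, k). int k < A $ i $ j}"

definition edge_shift :: "int ^ 'n ^ 'n \<Rightarrow> (int \<Rightarrow> 'n edge) set" where
  "edge_shift A =
     {x. \<forall>n. x n \<in> edges A \<and> fst (snd (x n)) = fst (x (n + 1))}"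

definition left_shift :: "(int \<Rightarrow> 'e) \<Rightarrow> (int \<Rightarrow> 'e)" where
  "left_shift x = (\<lambda>n. x (n + 1))"


section \<open>Inductive limits of stationary systems\<close>

text \<open>The limit of \<open>C \<rightarrow> C \<rightarrow> \<dots>\<close> along a single map \<open>\<phi>\<close>: the pair \<open>(x, N)\<close> is the
  element \<open>x\<close> of the \<open>N\<close>-th copy of \<open>C\<close>, and two pairs are identified when they agree at
  some later stage \<open>L\<close>.\<close>

definition ilim_rel :: "'a set \<Rightarrow> ('a \<Rightarrow> 'a) \<Rightarrow> (('a \<times> nat) \<times> ('a \<times> nat)) set" where
  "ilim_rel C \<phi> = {((x, N), (y, M)). x \<in> C \<and> y \<in> C \<and>
     (\<exists>L. N \<le> L \<and> M \<le> L \<and> (\<phi> ^^ (L - N)) x = (\<phi> ^^ (L - M)) y)}"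

definition ilim :: "'a set \<Rightarrow> ('a \<Rightarrow> 'a) \<Rightarrow> ('a \<times> nat) set set" where
  "ilim C \<phi> = (C \<times> UNIV) // ilim_rel C \<phi>"

definition ilim_class :: "'a set \<Rightarrow> ('a \<Rightarrow> 'a) \<Rightarrow> 'a \<Rightarrow> nat \<Rightarrow> ('a \<times> nat) set" where
  "ilim_class C \<phi> x N = ilim_rel C \<phi> `` {(x, N)}"

text \<open>Classes are added by choosing representatives at a common stage; the union runs over
  all such choices, which yield the same class (\<open>ilim_add_class\<close> below).\<close>

definition ilim_add ::
  "'a set \<Rightarrow> ('a \<Rightarrow> 'a) \<Rightarrow> ('a :: plus \<times> nat) set \<Rightarrow> ('a \<times> nat) set \<Rightarrow> ('a \<times> nat) set" where
  "ilim_add C \<phi> U V =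
     (\<Union>N. \<Union>x \<in> {x. (x, N) \<in> U}. \<Union>y \<in> {y. (y, N) \<in> V}. ilim_class C \<phi> (x + y) N)"


section \<open>The dimension group\<close>

text \<open>Ordered abelian groups, written in the multiplicative notation of HOL-Algebra.\<close>

record 'a ordered_group = "'a monoid" +
  positive_cone :: "'a set"

text \<open>\<open>K\<^sub>0(S(\<Sigma>, \<sigma>, P))\<close> as an ordered group, in its description as the limit of the row vectors
  under \<open>v \<mapsto> v A\<close>.  It does not depend on the choice of the finite invariant set \<open>P\<close>.\<close>

definition dimension_group ::
  "int ^ 'n ^ 'n \<Rightarrow> ((int ^ 'n) \<times> nat) set ordered_group" where
  "dimension_group A = (let \<phi> = (\<lambda>v. v v* A) in
     \<lparr> carrier = ilim UNIV \<phi>,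
       mult = ilim_add UNIV \<phi>,
       one = ilim_class UNIV \<phi> 0 0,
       positive_cone =
         {ilim_class UNIV \<phi> v N | v N. \<exists>m. \<forall>i. 0 \<le> ((\<phi> ^^ m) v) $ i} \<rparr>)"

definition order_embedding ::
  "('a, 'm) ordered_group_scheme \<Rightarrow> ('a \<Rightarrow> real ^ 'k) \<Rightarrow> bool" where
  "order_embedding G \<theta> \<longleftrightarrow>
     inj_on \<theta> (carrier G) \<and>
     (\<forall>x \<in> carrier G. \<forall>y \<in> carrier G. \<theta> (x \<otimes>\<^bsub>G\<^esub> y) = \<theta> x + \<theta> y) \<and>
     (\<forall>x \<in> carrier G. x \<in> positive_cone G \<longleftrightarrow> (\<forall>i. 0 \<le> \<theta> x $ i))"

text \<open>Continuity is with respect to the topology that \<open>G\<close> inherits through \<open>\<theta>\<close>.  The functions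
  are made extensional so that equality in the ring is equality on the carrier.\<close>

definition continuous_End ::
  "('a, 'm) monoid_scheme \<Rightarrow> ('a \<Rightarrow> 'b :: topological_space) \<Rightarrow> ('a \<Rightarrow> 'a) ring" where
  "continuous_End G \<theta> = (let T = pullback_topology (carrier G) \<theta> euclidean in
     \<lparr> carrier = {f \<in> hom G G \<inter> extensional (carrier G). continuous_map T T f},
       mult = compose (carrier G),
       one = (\<lambda>x \<in> carrier G. x),
       ring.zero = (\<lambda>x \<in> carrier G. \<one>\<^bsub>G\<^esub>),
       ring.add = (\<lambda>f g. \<lambda>x \<in> carrier G. f x \<otimes>\<^bsub>G\<^esub> g x) \<rparr>)"


section \<open>The ring of the homoclinic algebra\<close>

definition commutant :: "int ^ 'n ^ 'n \<Rightarrow> (int ^ 'n ^ 'n) set" where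
  "commutant A = {X. A ** X = X ** A}"

text \<open>The ring \<open>K\<^sub>0(C(H, \<alpha>))\<close> in its explicit form, the limit of \<open>X \<mapsto> A X A\<close> on the commutant
  of \<open>A\<close>, with product \<open>[X, N] * [Y, M] = [X Y, N + M]\<close>.\<close>

definition homoclinic_K0_ring ::
  "int ^ 'n ^ 'n \<Rightarrow> ((int ^ 'n ^ 'n) \<times> nat) set ring" where
  "homoclinic_K0_ring A = (let C = commutant A; \<phi> = (\<lambda>X. A ** X ** A) in
     \<lparr> carrier = ilim C \<phi>,
       mult = (\<lambda>U V. \<Union>(X, N) \<in> U. \<Union>(Y, M) \<in> V. ilim_class C \<phi> (X ** Y) (N + M)),
       one = ilim_class C \<phi> (mat 1) 0,
       ring.zero = ilim_class C \<phi> 0 0,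
       ring.add = ilim_add C \<phi> \<rparr>)"


section \<open>Well-definedness\<close>

locale stationary_system =
  fixes C :: "'a :: ab_group_add set" and \<phi> :: "'a \<Rightarrow> 'a"
  assumes zero_mem: "0 \<in> C"
    and add_mem: "x \<in> C \<Longrightarrow> y \<in> C \<Longrightarrow> x + y \<in> C"
    and minus_mem: "x \<in> C \<Longrightarrow> - x \<in> C"
    and map_mem: "x \<in> C \<Longrightarrow> \<phi> x \<in> C"
    and map_add: "\<phi> (x + y) = \<phi> x + \<phi> y"
begin

abbreviation "cls \<equiv> ilim_class C \<phi>"

lemma pow_mem: "x \<in> C \<Longrightarrow> (\<phi> ^^ n) x \<in> C"
  by (induction n) (auto intro: map_mem)

lemma pow_add: "(\<phi> ^^ n) (x + y) = (\<phi> ^^ n) x + (\<phi> ^^ n) y"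
  by (induction n) (auto simp: map_add)

lemma eq_later:
  assumes "(\<phi> ^^ (L - N)) x = (\<phi> ^^ (L - M)) y" "N \<le> L" "M \<le> L" "L \<le> L'"
  shows "(\<phi> ^^ (L' - N)) x = (\<phi> ^^ (L' - M)) y"
proof -
  have "L' - N = (L' - L) + (L - N)" "L' - M = (L' - L) + (L - M)"
    using assms by auto
  then show ?thesis using assms(1) by (simp add: funpow_add)
qed

lemma equiv_rel: "equiv (C \<times> UNIV) (ilim_rel C \<phi>)"
proof (rule equivI)
  show "ilim_rel C \<phi> \<subseteq> (C \<times> UNIV) \<times> C \<times> UNIV"
    by (auto simp: ilim_rel_def)
  show "refl_on (C \<times> UNIV) (ilim_rel C \<phi>)"
    by (auto simp: refl_on_def ilim_rel_def)
  show "sym (ilim_rel C \<phi>)"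
    unfolding sym_def ilim_rel_def by fastforce
  show "trans (ilim_rel C \<phi>)"
  proof (rule transI, clarify)
    fix x N y M z K
    assume 1: "((x, N), (y, M)) \<in> ilim_rel C \<phi>" and 2: "((y, M), (z, K)) \<in> ilim_rel C \<phi>"
    obtain L where L: "N \<le> L" "M \<le> L" "(\<phi> ^^ (L - N)) x = (\<phi> ^^ (L - M)) y"
      using 1 by (auto simp: ilim_rel_def)
    obtain L' where L': "M \<le> L'" "K \<le> L'" "(\<phi> ^^ (L' - M)) y = (\<phi> ^^ (L' - K)) z"
      using 2 by (auto simp: ilim_rel_def)
    have "(\<phi> ^^ (L + L' - N)) x = (\<phi> ^^ (L + L' - K)) z"
      using eq_later[OF L(3), of "L + L'"] eq_later[OF L'(3), of "L + L'"] L L' by simp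
    then show "((x, N), (z, K)) \<in> ilim_rel C \<phi>"
      using 1 2 L L' unfolding ilim_rel_def by (fastforce intro: exI[of _ "L + L'"])
  qed
qed

lemma class_mem: "x \<in> C \<Longrightarrow> cls x N \<in> ilim C \<phi>"
  by (auto simp: ilim_class_def ilim_def intro!: quotientI)

lemma mem_class_iff: "(y, M) \<in> cls x N \<longleftrightarrow> ((x, N), (y, M)) \<in> ilim_rel C \<phi>"
  by (auto simp: ilim_class_def)

lemma class_eq_iff:
  assumes "x \<in> C" "y \<in> C"
  shows "cls x N = cls y M \<longleftrightarrow>
    (\<exists>L. N \<le> L \<and> M \<le> L \<and> (\<phi> ^^ (L - N)) x = (\<phi> ^^ (L - M)) y)"
proof -
  have "cls x N = cls y M \<longleftrightarrow> ((x, N), (y, M)) \<in> ilim_rel C \<phi>"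
    using eq_equiv_class_iff[OF equiv_rel] assms by (auto simp: ilim_class_def)
  then show ?thesis using assms by (auto simp: ilim_rel_def)
qed

lemma class_shift:
  assumes "x \<in> C"
  shows "cls ((\<phi> ^^ n) x) (N + n) = cls x N"
  using assms by (auto simp: class_eq_iff pow_mem intro!: exI[of _ "N + n"])

lemma ilim_cases:
  assumes "U \<in> ilim C \<phi>"
  obtains x N where "x \<in> C" "U = cls x N"
  using assms by (auto simp: ilim_def ilim_class_def elim!: quotientE)

lemma ilim_stage:
  assumes "U \<in> ilim C \<phi>"
  shows "\<exists>N. \<forall>L \<ge> N. \<exists>x \<in> C. U = cls x L"
proof -
  obtain x N where x: "x \<in> C" "U = cls x N" using assms by (rule ilim_cases)
  have "\<exists>x \<in> C. U = cls x L" if "N \<le> L" for L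
    using class_shift[OF x(1), of "L - N" N] that x pow_mem[OF x(1), of "L - N"]
    by (auto intro!: bexI[of _ "(\<phi> ^^ (L - N)) x"])
  then show ?thesis by blast
qed

lemma ilim_cases3:
  assumes "U \<in> ilim C \<phi>" "V \<in> ilim C \<phi>" "W \<in> ilim C \<phi>"
  obtains x y z N where "x \<in> C" "y \<in> C" "z \<in> C" "U = cls x N" "V = cls y N" "W = cls z N"
proof -
  obtain N1 N2 N3 where N: "\<forall>L \<ge> N1. \<exists>x \<in> C. U = cls x L"
      "\<forall>L \<ge> N2. \<exists>x \<in> C. V = cls x L" "\<forall>L \<ge> N3. \<exists>x \<in> C. W = cls x L"
    using assms[THEN ilim_stage] by blast
  then have "\<exists>x \<in> C. U = cls x (N1 + N2 + N3)" "\<exists>x \<in> C. V = cls x (N1 + N2 + N3)"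
      "\<exists>x \<in> C. W = cls x (N1 + N2 + N3)"
    by simp_all
  then show thesis using that by blast
qed

lemma ilim_add_class:
  assumes "x \<in> C" "y \<in> C"
  shows "ilim_add C \<phi> (cls x N) (cls y N) = cls (x + y) N"
proof -
  have "cls (x' + y') M = cls (x + y) N"
    if x': "(x', M) \<in> cls x N" and y': "(y', M) \<in> cls y N" for x' y' M
  proof -
    obtain L where L: "N \<le> L" "M \<le> L" "(\<phi> ^^ (L - N)) x = (\<phi> ^^ (L - M)) x'" "x' \<in> C"
      using x' by (auto simp: mem_class_iff ilim_rel_def)
    obtain L' where L': "N \<le> L'" "M \<le> L'" "(\<phi> ^^ (L' - N)) y = (\<phi> ^^ (L' - M)) y'" "y' \<in> C"
      using y' by (auto simp: mem_class_iff ilim_rel_def)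
    have "(\<phi> ^^ (L + L' - M)) (x' + y') = (\<phi> ^^ (L + L' - N)) (x + y)"
      using eq_later[OF L(3), of "L + L'"] eq_later[OF L'(3), of "L + L'"] L L'
      by (simp add: pow_add)
    then show ?thesis
      using L L' assms by (subst class_eq_iff) (auto intro: add_mem exI[of _ "L + L'"])
  qed
  moreover have "(x, N) \<in> cls x N" "(y, N) \<in> cls y N"
    using assms by (auto simp: mem_class_iff ilim_rel_def)
  ultimately show ?thesis unfolding ilim_add_def by blast
qed

lemma zero_class: "cls 0 N = cls 0 0"
proof -
  have "(\<phi> ^^ n) 0 = 0" for n using pow_add[of n 0 0] by simp
  then show ?thesis using class_shift[OF zero_mem, of N 0] by simp
qed

lemma comm_group_ilim:
  assumes G: "carrier G = ilim C \<phi>" "mult G = ilim_add C \<phi>" "one G = cls 0 0"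
  shows "comm_group G"
proof (rule comm_groupI, unfold G)
  fix U V W assume U: "U \<in> ilim C \<phi>" and V: "V \<in> ilim C \<phi>"
  show "ilim_add C \<phi> U V \<in> ilim C \<phi>"
    using U V V by (rule ilim_cases3) (simp add: ilim_add_class class_mem add_mem)
  show "ilim_add C \<phi> U V = ilim_add C \<phi> V U"
    using U V V by (rule ilim_cases3) (simp add: ilim_add_class add.commute)
  show "ilim_add C \<phi> (ilim_add C \<phi> U V) W = ilim_add C \<phi> U (ilim_add C \<phi> V W)"
    if W: "W \<in> ilim C \<phi>"
    using U V W by (rule ilim_cases3) (simp add: ilim_add_class add_mem add.assoc)
next
  show "cls 0 0 \<in> ilim C \<phi>" by (simp add: class_mem zero_mem)
next
  fix U assume "U \<in> ilim C \<phi>"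
  then obtain x N where x: "x \<in> C" "U = cls x N" by (rule ilim_cases)
  then show "ilim_add C \<phi> (cls 0 0) U = U"
    using ilim_add_class[OF zero_mem x(1), of N] by (simp add: zero_class[of N])
  show "\<exists>V \<in> ilim C \<phi>. ilim_add C \<phi> V U = cls 0 0"
    using x ilim_add_class[OF minus_mem[OF x(1)] x(1), of N]
    by (intro bexI[of _ "cls (- x) N"]) (simp_all add: zero_class[of N] class_mem minus_mem)
qed

end

lemma stationary_system_rows: "stationary_system UNIV (\<lambda>v :: int ^ 'n. v v* A)"
  by unfold_locales (auto simp: vector_matrix_left_distrib)

lemma comm_group_dimension_group: "comm_group (dimension_group A)"
  by (rule stationary_system.comm_group_ilim[OF stationary_system_rows])
    (simp_all add: dimension_group_def Let_def)

lemma matrix_add_minus: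
  fixes A X Y :: "int ^ 'n ^ 'n"
  shows "A ** (X + Y) = A ** X + A ** Y" "(X + Y) ** A = X ** A + Y ** A"
    "A ** (- X) = - (A ** X)" "(- X) ** A = - (X ** A)" "A ** 0 = 0" "0 ** A = 0"
  by (simp_all add: matrix_matrix_mult_def vec_eq_iff sum.distrib sum_negf algebra_simps)

lemma stationary_system_commutant:
  "stationary_system (commutant A) (\<lambda>X :: int ^ 'n ^ 'n. A ** X ** A)"
proof unfold_locales
  fix X assume "X \<in> commutant A"
  then show "A ** X ** A \<in> commutant A"
    unfolding commutant_def mem_Collect_eq by (metis matrix_mul_assoc)
qed (auto simp: commutant_def matrix_add_minus)

lemma commutant_mult: "X \<in> commutant A \<Longrightarrow> Y \<in> commutant A \<Longrightarrow> X ** Y \<in> commutant A"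
  unfolding commutant_def mem_Collect_eq by (metis matrix_mul_assoc)

lemma homoclinic_pow_mult:
  fixes A :: "int ^ 'n ^ 'n"
  assumes X: "X \<in> commutant A" and Y: "Y \<in> commutant A"
  defines "\<phi> \<equiv> \<lambda>X. A ** X ** A"
  shows "(\<phi> ^^ n) X ** (\<phi> ^^ m) Y = (\<phi> ^^ (n + m)) (X ** Y)"
proof -
  interpret stationary_system "commutant A" \<phi>
    unfolding \<phi>_def by (rule stationary_system_commutant)
  have l: "\<phi> P ** Q = \<phi> (P ** Q)" if "P \<in> commutant A" "Q \<in> commutant A" for P Q
    using that unfolding \<phi>_def commutant_def mem_Collect_eq by (metis matrix_mul_assoc)
  have r: "P ** \<phi> Q = \<phi> (P ** Q)" if "P \<in> commutant A" "Q \<in> commutant A" for P Q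
    using that unfolding \<phi>_def commutant_def mem_Collect_eq by (metis matrix_mul_assoc)
  have 1: "(\<phi> ^^ n) X ** Q = (\<phi> ^^ n) (X ** Q)" if "Q \<in> commutant A" for Q
    using that X by (induction n) (simp_all add: l pow_mem)
  have 2: "X ** (\<phi> ^^ m) Y = (\<phi> ^^ m) (X ** Y)"
    using X Y by (induction m) (simp_all add: r pow_mem)
  show ?thesis using 1[OF pow_mem[OF Y]] 2 by (simp add: funpow_add)
qed

lemma homoclinic_mult_class:
  fixes A :: "int ^ 'n ^ 'n"
  assumes X: "X \<in> commutant A" and Y: "Y \<in> commutant A"
  defines "\<phi> \<equiv> \<lambda>X. A ** X ** A"
  shows "ilim_class (commutant A) \<phi> X N \<otimes>\<^bsub>homoclinic_K0_ring A\<^esub> ilim_class (commutant A) \<phi> Y M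
    = ilim_class (commutant A) \<phi> (X ** Y) (N + M)"
proof -
  interpret stationary_system "commutant A" \<phi>
    unfolding \<phi>_def by (rule stationary_system_commutant)
  have pm: "(\<phi> ^^ n) P ** (\<phi> ^^ m) Q = (\<phi> ^^ (n + m)) (P ** Q)"
    if "P \<in> commutant A" "Q \<in> commutant A" for P Q n m
    using homoclinic_pow_mult[OF that] by (simp add: \<phi>_def)
  have eq: "cls (X' ** Y') (N' + M') = cls (X ** Y) (N + M)"
    if X': "(X', N') \<in> cls X N" and Y': "(Y', M') \<in> cls Y M" for X' Y' N' M'
  proof -
    obtain L where L: "N \<le> L" "N' \<le> L" "(\<phi> ^^ (L - N)) X = (\<phi> ^^ (L - N')) X'"
        "X' \<in> commutant A"
      using X' by (auto simp: mem_class_iff ilim_rel_def)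
    obtain L' where L': "M \<le> L'" "M' \<le> L'" "(\<phi> ^^ (L' - M)) Y = (\<phi> ^^ (L' - M')) Y'"
        "Y' \<in> commutant A"
      using Y' by (auto simp: mem_class_iff ilim_rel_def)
    have "(\<phi> ^^ ((L - N') + (L' - M'))) (X' ** Y') = (\<phi> ^^ ((L - N) + (L' - M))) (X ** Y)"
      using pm[OF L(4) L'(4), of "L - N'" "L' - M'"] pm[OF X Y, of "L - N" "L' - M"] L(3) L'(3)
      by simp
    moreover have "(L - N') + (L' - M') = L + L' - (N' + M')"
        "(L - N) + (L' - M) = L + L' - (N + M)"
      using L L' by auto
    ultimately show ?thesis
      using L L' X Y
      by (subst class_eq_iff) (auto simp: commutant_mult intro!: exI[of _ "L + L'"])
  qed
  have self: "(X, N) \<in> cls X N" "(Y, M) \<in> cls Y M"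
    using X Y by (auto simp: mem_class_iff ilim_rel_def)
  have "(\<Union>(X', N') \<in> cls X N. \<Union>(Y', M') \<in> cls Y M. cls (X' ** Y') (N' + M'))
      = cls (X ** Y) (N + M)" (is "?U = _")
  proof (rule equalityI)
    show "?U \<subseteq> cls (X ** Y) (N + M)" using eq by fast
    show "cls (X ** Y) (N + M) \<subseteq> ?U" using self by fast
  qed
  then show ?thesis by (simp add: homoclinic_K0_ring_def Let_def \<phi>_def)
qed

lemma ring_homoclinic_K0_ring:
  fixes A :: "int ^ 'n ^ 'n"
  shows "ring (homoclinic_K0_ring A)"
proof -
  define \<phi> where "\<phi> = (\<lambda>X. A ** X ** A)"
  interpret stationary_system "commutant A" \<phi>
    unfolding \<phi>_def by (rule stationary_system_commutant)
  let ?R = "homoclinic_K0_ring A"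
  have R: "carrier ?R = ilim (commutant A) \<phi>" "add ?R = ilim_add (commutant A) \<phi>"
      "\<zero>\<^bsub>?R\<^esub> = cls 0 0" "\<one>\<^bsub>?R\<^esub> = cls (mat 1) 0"
    by (simp_all add: homoclinic_K0_ring_def Let_def \<phi>_def)
  have mult: "cls X N \<otimes>\<^bsub>?R\<^esub> cls Y M = cls (X ** Y) (N + M)"
    if "X \<in> commutant A" "Y \<in> commutant A" for X Y N M
    using homoclinic_mult_class[OF that] by (simp add: \<phi>_def)
  have one: "mat 1 \<in> commutant A" by (simp add: commutant_def)
  have "comm_group (add_monoid ?R)"
    by (rule comm_group_ilim) (simp_all add: R)
  then have "abelian_group ?R"
    by (simp add: abelian_group_def abelian_group_axioms_def abelian_monoid_def comm_group_def)
  moreover have "Group.monoid ?R"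
  proof (rule monoidI)
    fix U V W assume U: "U \<in> carrier ?R" and V: "V \<in> carrier ?R"
    show "U \<otimes>\<^bsub>?R\<^esub> V \<in> carrier ?R"
      using U V V unfolding R
      by (rule ilim_cases3) (simp add: mult class_mem commutant_mult)
    assume W: "W \<in> carrier ?R"
    show "U \<otimes>\<^bsub>?R\<^esub> V \<otimes>\<^bsub>?R\<^esub> W = U \<otimes>\<^bsub>?R\<^esub> (V \<otimes>\<^bsub>?R\<^esub> W)"
      using U V W unfolding R
      by (rule ilim_cases3) (simp add: mult commutant_mult matrix_mul_assoc add.assoc)
  next
    show "\<one>\<^bsub>?R\<^esub> \<in> carrier ?R" by (simp add: R class_mem one)
  next
    fix U assume "U \<in> carrier ?R"
    then obtain X N where "X \<in> commutant A" "U = cls X N" unfolding R by (rule ilim_cases)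
    then show "\<one>\<^bsub>?R\<^esub> \<otimes>\<^bsub>?R\<^esub> U = U" "U \<otimes>\<^bsub>?R\<^esub> \<one>\<^bsub>?R\<^esub> = U"
      by (simp_all add: R mult one)
  qed
  moreover have "(U \<oplus>\<^bsub>?R\<^esub> V) \<otimes>\<^bsub>?R\<^esub> W = U \<otimes>\<^bsub>?R\<^esub> W \<oplus>\<^bsub>?R\<^esub> V \<otimes>\<^bsub>?R\<^esub> W"
      "W \<otimes>\<^bsub>?R\<^esub> (U \<oplus>\<^bsub>?R\<^esub> V) = W \<otimes>\<^bsub>?R\<^esub> U \<oplus>\<^bsub>?R\<^esub> W \<otimes>\<^bsub>?R\<^esub> V"
    if "U \<in> carrier ?R" "V \<in> carrier ?R" "W \<in> carrier ?R" for U V W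
    using that unfolding R
    by (auto elim!: ilim_cases3[of U V W]
        simp: mult ilim_add_class add_mem commutant_mult matrix_add_minus)
  ultimately show ?thesis by (intro ring.intro ring_axioms.intro) auto
qed

lemma ring_continuous_End:
  fixes G (structure) and \<theta> :: "'a \<Rightarrow> 'b :: real_normed_vector"
  assumes G: "comm_group G"
    and add: "\<And>x y. x \<in> carrier G \<Longrightarrow> y \<in> carrier G \<Longrightarrow> \<theta> (x \<otimes>\<^bsub>G\<^esub> y) = \<theta> x + \<theta> y"
  shows "ring (continuous_End G \<theta>)"
proof -
  interpret comm_group G by (rule G)
  define T where "T = pullback_topology (carrier G) \<theta> euclidean"
  have top: "topspace T = carrier G" by (simp add: T_def topspace_pullback_topology)
  have \<theta>_cont: "continuous_map T euclidean \<theta>"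
    unfolding T_def by (metis continuous_map_pullback continuous_map_id comp_id id_comp)
  have cont_iff: "continuous_map T T f \<longleftrightarrow> continuous_map T euclidean (\<theta> \<circ> f)"
    if "f \<in> carrier G \<rightarrow> carrier G" for f
  proof
    show "continuous_map T euclidean (\<theta> \<circ> f)" if "continuous_map T T f"
      using that \<theta>_cont by (rule continuous_map_compose)
    show "continuous_map T T f" if "continuous_map T euclidean (\<theta> \<circ> f)"
      unfolding T_def
    proof (rule continuous_map_pullback')
      show "continuous_map (pullback_topology (carrier G) \<theta> euclidean) euclidean (\<theta> \<circ> f)"
        using that by (simp add: T_def)
      show "topspace (pullback_topology (carrier G) \<theta> euclidean) \<subseteq> f -` carrier G"
        using \<open>f \<in> carrier G \<rightarrow> carrier G\<close> by (auto simp: topspace_pullback_topology)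
    qed
  qed
  let ?R = "continuous_End G \<theta>"
  have carr: "f \<in> carrier ?R \<longleftrightarrow>
      f \<in> hom G G \<and> f \<in> extensional (carrier G) \<and> continuous_map T T f" for f
    by (auto simp: continuous_End_def Let_def T_def)
  have ops: "f \<otimes>\<^bsub>?R\<^esub> g = compose (carrier G) f g"
      "f \<oplus>\<^bsub>?R\<^esub> g = (\<lambda>x \<in> carrier G. f x \<otimes> g x)"
      "\<one>\<^bsub>?R\<^esub> = (\<lambda>x \<in> carrier G. x)" "\<zero>\<^bsub>?R\<^esub> = (\<lambda>x \<in> carrier G. \<one>)" for f g
    by (simp_all add: continuous_End_def Let_def)
  have hom: "f x \<in> carrier G" "f (x \<otimes> y) = f x \<otimes> f y"
    if "f \<in> carrier ?R" "x \<in> carrier G" "y \<in> carrier G" for f x y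
    using that by (auto simp: carr hom_def)
  have hom_one: "f \<one> = \<one>" if "f \<in> carrier ?R" for f
    using that is_group by (auto simp: carr intro: hom_one)
  have \<theta>_one: "\<theta> \<one> = 0" using add[of \<one> \<one>] by simp
  have \<theta>_inv: "\<theta> (inv x) = - \<theta> x" if "x \<in> carrier G" for x
    using add[OF that inv_closed[OF that]] that \<theta>_one by (simp add: eq_neg_iff_add_eq_0 add.commute)
  have memI: "f \<in> carrier ?R"
    if "\<And>x. x \<in> carrier G \<Longrightarrow> f x \<in> carrier G"
      "\<And>x y. x \<in> carrier G \<Longrightarrow> y \<in> carrier G \<Longrightarrow> f (x \<otimes> y) = f x \<otimes> f y"
      "f \<in> extensional (carrier G)" "continuous_map T euclidean (\<theta> \<circ> f)" for f
    using that cont_iff[of f] by (auto simp: carr hom_def)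
  have \<theta>f: "continuous_map T euclidean (\<theta> \<circ> f)" if "f \<in> carrier ?R" for f
    using that \<theta>_cont by (auto simp: carr intro: continuous_map_compose)
  have plus_mem: "f \<oplus>\<^bsub>?R\<^esub> g \<in> carrier ?R" if f: "f \<in> carrier ?R" and g: "g \<in> carrier ?R" for f g
  proof (rule memI)
    show "continuous_map T euclidean (\<theta> \<circ> (f \<oplus>\<^bsub>?R\<^esub> g))"
      using continuous_map_add[OF \<theta>f[OF f] \<theta>f[OF g]]
      by (rule continuous_map_eq) (simp add: top ops add hom[OF f] hom[OF g])
  qed (auto simp: ops hom[OF f] hom[OF g] m_ac)
  have zero_mem: "\<zero>\<^bsub>?R\<^esub> \<in> carrier ?R"
  proof (rule memI)
    have "continuous_map T euclidean (\<lambda>x. 0 :: 'b)" by simp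
    then show "continuous_map T euclidean (\<theta> \<circ> \<zero>\<^bsub>?R\<^esub>)"
      by (rule continuous_map_eq) (simp add: top ops \<theta>_one)
  qed (auto simp: ops)
  have one_mem: "\<one>\<^bsub>?R\<^esub> \<in> carrier ?R"
  proof (rule memI)
    show "continuous_map T euclidean (\<theta> \<circ> \<one>\<^bsub>?R\<^esub>)"
      using \<theta>_cont by (rule continuous_map_eq) (simp add: top ops)
  qed (auto simp: ops)
  have mult_mem: "f \<otimes>\<^bsub>?R\<^esub> g \<in> carrier ?R" if f: "f \<in> carrier ?R" and g: "g \<in> carrier ?R" for f g
  proof (rule memI)
    have "continuous_map T T g" using g by (simp add: carr)
    from continuous_map_compose[OF this \<theta>f[OF f]]
    show "continuous_map T euclidean (\<theta> \<circ> (f \<otimes>\<^bsub>?R\<^esub> g))"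
      by (rule continuous_map_eq) (simp add: top ops compose_def)
  qed (auto simp: ops compose_def hom[OF f] hom[OF g])
  have neg: "\<exists>g \<in> carrier ?R. g \<oplus>\<^bsub>?R\<^esub> f = \<zero>\<^bsub>?R\<^esub>" if f: "f \<in> carrier ?R" for f
  proof
    let ?g = "\<lambda>x \<in> carrier G. inv (f x)"
    show "?g \<in> carrier ?R"
    proof (rule memI)
      show "continuous_map T euclidean (\<theta> \<circ> ?g)"
        using continuous_map_minus[OF \<theta>f[OF f]]
        by (rule continuous_map_eq) (simp add: top \<theta>_inv hom[OF f])
    qed (auto simp: hom[OF f] inv_mult)
    show "?g \<oplus>\<^bsub>?R\<^esub> f = \<zero>\<^bsub>?R\<^esub>"
      unfolding ops by (rule restrict_ext) (simp add: hom[OF f])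
  qed
  have ext: "f = g" if "f \<in> carrier ?R" "g \<in> carrier ?R" "\<And>x. x \<in> carrier G \<Longrightarrow> f x = g x" for f g
    using that by (auto simp: carr intro: extensionalityI)
  note app = ops compose_def hom hom_one m_assoc
  have "abelian_group ?R"
  proof (rule abelian_groupI)
    fix f g h assume f: "f \<in> carrier ?R" and g: "g \<in> carrier ?R"
    show "f \<oplus>\<^bsub>?R\<^esub> g = g \<oplus>\<^bsub>?R\<^esub> f"
      by (rule ext) (use f g in \<open>simp_all add: plus_mem, simp add: app m_comm\<close>)
    assume h: "h \<in> carrier ?R"
    show "f \<oplus>\<^bsub>?R\<^esub> g \<oplus>\<^bsub>?R\<^esub> h = f \<oplus>\<^bsub>?R\<^esub> (g \<oplus>\<^bsub>?R\<^esub> h)"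
      by (rule ext) (use f g h in \<open>simp_all add: plus_mem, simp add: app\<close>)
  next
    fix f assume f: "f \<in> carrier ?R"
    show "\<zero>\<^bsub>?R\<^esub> \<oplus>\<^bsub>?R\<^esub> f = f"
      by (rule ext) (use f in \<open>simp_all add: plus_mem zero_mem, simp add: app\<close>)
  qed (simp_all add: plus_mem zero_mem neg)
  moreover have "Group.monoid ?R"
  proof (rule monoidI)
    fix f g h assume f: "f \<in> carrier ?R" and g: "g \<in> carrier ?R" and h: "h \<in> carrier ?R"
    show "f \<otimes>\<^bsub>?R\<^esub> g \<otimes>\<^bsub>?R\<^esub> h = f \<otimes>\<^bsub>?R\<^esub> (g \<otimes>\<^bsub>?R\<^esub> h)"
      by (rule ext) (use f g h in \<open>simp_all add: mult_mem, simp add: app\<close>)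
  next
    fix f assume f: "f \<in> carrier ?R"
    show "\<one>\<^bsub>?R\<^esub> \<otimes>\<^bsub>?R\<^esub> f = f"
      by (rule ext) (use f in \<open>simp_all add: mult_mem one_mem, simp add: app\<close>)
    show "f \<otimes>\<^bsub>?R\<^esub> \<one>\<^bsub>?R\<^esub> = f"
      by (rule ext) (use f in \<open>simp_all add: mult_mem one_mem, simp add: app\<close>)
  qed (simp_all add: mult_mem one_mem)
  moreover have "(f \<oplus>\<^bsub>?R\<^esub> g) \<otimes>\<^bsub>?R\<^esub> h = f \<otimes>\<^bsub>?R\<^esub> h \<oplus>\<^bsub>?R\<^esub> g \<otimes>\<^bsub>?R\<^esub> h"
    if f: "f \<in> carrier ?R" and g: "g \<in> carrier ?R" and h: "h \<in> carrier ?R" for f g h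
    by (rule ext) (use f g h in \<open>simp_all add: plus_mem mult_mem, simp add: app\<close>)
  moreover have "h \<otimes>\<^bsub>?R\<^esub> (f \<oplus>\<^bsub>?R\<^esub> g) = h \<otimes>\<^bsub>?R\<^esub> f \<oplus>\<^bsub>?R\<^esub> h \<otimes>\<^bsub>?R\<^esub> g"
    if f: "f \<in> carrier ?R" and g: "g \<in> carrier ?R" and h: "h \<in> carrier ?R" for f g h
    by (rule ext) (use f g h in \<open>simp_all add: plus_mem mult_mem, simp add: app\<close>)
  ultimately show ?thesis by (intro ring.intro ring_axioms.intro) auto
qed

end

theory Submission
  imports Defs
begin

text \<open>The argument rests on one comparison principle and one identification.

  The comparison is a Harnack inequality. A positive homomorphism on the dimension group \<open>G\<close> is a
  sequence of positive functionals on the stages, compatible with \<open>v \<mapsto> v A\<close>. Some power of \<open>A\<close> has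
  strictly positive entries, so after a fixed number of steps every vector \<open>v \<ge> 0\<close> lies between two
  fixed multiples of \<open>|v|\<close> times the all-ones vector, where \<open>|v|\<close> is the sum of the entries. Hence a
  nonzero positive homomorphism dominates every other one on the positive cone, up to a constant
  (\<open>positive_functional_harnack\<close>). This takes the place of the Perron--Frobenius theorem.

  The Harnack inequality forces the dimension of the embedding to be one: two different coordinates
  of \<open>\<theta>\<close> would be comparable on the positive cone, while density provides positive elements on which
  their ratio is arbitrarily large (\<open>coordinate_unique\<close>). So \<open>G\<close> is a dense subgroup of the real line,
  embedded by \<open>\<tau>\<close>, its order is total, and a continuous endomorphism is multiplication by a real
  number (\<open>continuous_End_scalar\<close>). In particular continuous endomorphisms commute.

  The isomorphism sends \<open>[X, N]\<close> to the endomorphism \<open>[v, M] \<mapsto> [v X, M + 2 N]\<close>; the factor two is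
  there because one step \<open>X \<mapsto> A X A\<close> in the ring is two steps in \<open>G\<close>. Letting matrices act on rows from
  the right reverses products, which is harmless because the target is commutative. The image consists of
  continuous maps: for \<open>X \<ge> 0\<close> the composition with \<open>\<tau>\<close> is a positive homomorphism, so Harnack bounds
  it by a multiple of \<open>\<tau>\<close>, and a general \<open>X\<close> in the commutant is a difference of two non-negative
  ones (\<open>commutant_dominated\<close>, \<open>act_mem\<close>). Conversely a continuous endomorphism commutes with
  the shift \<open>[v, M] \<mapsto> [v A, M]\<close>; recording its values on the unit vectors of stage \<open>0\<close> as the rows of a
  matrix and moving to a late enough stage yields a matrix commuting with \<open>A\<close> that induces it
  (\<open>act_surj\<close>).\<close>


section \<open>Additive maps on dense subgroups of the line\<close>

lemma additive_int_multiple: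
  fixes F :: "real \<Rightarrow> real"
  assumes D0: "0 \<in> D" and Dadd: "\<And>x y. x \<in> D \<Longrightarrow> y \<in> D \<Longrightarrow> x + y \<in> D"
    and Dneg: "\<And>x. x \<in> D \<Longrightarrow> - x \<in> D"
    and add: "\<And>x y. x \<in> D \<Longrightarrow> y \<in> D \<Longrightarrow> F (x + y) = F x + F y"
    and x: "x \<in> D"
  shows "of_int k * x \<in> D \<and> F (of_int k * x) = of_int k * F x"
proof -
  have F0: "F 0 = 0" using add[OF D0 D0] by simp
  have Fneg: "F (- y) = - F y" if "y \<in> D" for y
    using add[OF that Dneg[OF that]] F0 by simp
  have nat: "of_nat n * x \<in> D \<and> F (of_nat n * x) = of_nat n * F x" for n
    by (induction n) (auto simp: D0 F0 distrib_right Dadd add x)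
  show ?thesis
  proof (cases k)
    case (nonneg n) then show ?thesis using nat[of n] by simp
  next
    case (neg n)
    then show ?thesis using nat[of "Suc n"] Dneg[of "of_nat (Suc n) * x"] Fneg[of "of_nat (Suc n) * x"]
      by (simp del: of_nat_Suc)
  qed
qed

text \<open>Subtract from \<open>F\<close> the linear map that agrees with it at one small point \<open>x0\<close>. The difference
  \<open>H\<close> is periodic with period \<open>x0\<close> and bounded near \<open>0\<close>, hence bounded everywhere; a bounded additive
  map vanishes.\<close>

lemma additive_dense_linear:
  fixes F :: "real \<Rightarrow> real"
  assumes D0: "0 \<in> D" and Dadd: "\<And>x y. x \<in> D \<Longrightarrow> y \<in> D \<Longrightarrow> x + y \<in> D"
    and Dneg: "\<And>x. x \<in> D \<Longrightarrow> - x \<in> D"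
    and add: "\<And>x y. x \<in> D \<Longrightarrow> y \<in> D \<Longrightarrow> F (x + y) = F x + F y"
    and dense: "closure D = UNIV"
    and \<delta>: "0 < \<delta>" and bound: "\<And>x. x \<in> D \<Longrightarrow> \<bar>x\<bar> < \<delta> \<Longrightarrow> \<bar>F x\<bar> \<le> 1"
  shows "\<exists>c. \<forall>x \<in> D. F x = c * x"
proof -
  obtain x0 where x0: "x0 \<in> D" "0 < x0" "x0 < \<delta>"
  proof -
    have "\<delta> / 2 \<in> closure D" using dense by simp
    then obtain y where "y \<in> D" "dist y (\<delta> / 2) < \<delta> / 2"
      unfolding closure_approachable using \<delta> by (meson half_gt_zero)
    then show thesis using that[of y] by (auto simp: dist_real_def abs_if split: if_splits)
  qed
  define c where "c = F x0 / x0"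
  define H where "H x = F x - c * x" for x
  define K where "K = 1 + \<bar>c\<bar> * \<delta>"
  have Hadd: "H (x + y) = H x + H y" if "x \<in> D" "y \<in> D" for x y
    using add[OF that] by (simp add: H_def distrib_left)
  have mult: "of_int k * x \<in> D" "H (of_int k * x) = of_int k * H x" if "x \<in> D" for x k
    using additive_int_multiple[of D H, OF D0 _ _ _ that] Dadd Dneg Hadd by blast+
  have Hx0: "H x0 = 0" using x0 by (simp add: H_def c_def)
  have small: "\<bar>H x\<bar> \<le> K" if "x \<in> D" "\<bar>x\<bar> < \<delta>" for x
  proof -
    have "\<bar>c * x\<bar> \<le> \<bar>c\<bar> * \<delta>" using that by (simp add: abs_mult mult_left_mono)
    then show ?thesis using bound[OF that] unfolding H_def K_def by linarith
  qed
  \<comment> \<open>a multiple of the period moves \<open>x\<close> into \<open>[0, x0)\<close>, inside the \<open>\<delta>\<close>-neighbourhood\<close>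
  have all: "\<bar>H x\<bar> \<le> K" if x: "x \<in> D" for x
  proof -
    define k where "k = - \<lfloor>x / x0\<rfloor>"
    have m: "of_int k * x0 \<in> D" "H (of_int k * x0) = 0" using mult[OF x0(1)] Hx0 by auto
    have "of_int \<lfloor>x / x0\<rfloor> * x0 \<le> x" "x < (of_int \<lfloor>x / x0\<rfloor> + 1) * x0"
      using x0(2) by (simp add: pos_le_divide_eq[symmetric]) (simp add: pos_divide_less_eq[symmetric] x0)
    then have "\<bar>x + of_int k * x0\<bar> < \<delta>" using x0 by (simp add: k_def algebra_simps)
    then have "\<bar>H (x + of_int k * x0)\<bar> \<le> K" using small Dadd[OF x m(1)] by blast
    then show ?thesis using Hadd[OF x m(1)] m(2) by simp
  qed
  have "H x = 0" if x: "x \<in> D" for x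
  proof (rule ccontr)
    assume "H x \<noteq> 0"
    then obtain n :: nat where n: "K < of_nat n * \<bar>H x\<bar>" using ex_less_of_nat_mult[of "\<bar>H x\<bar>" K] by auto
    have "of_int (int n) * x \<in> D" "H (of_int (int n) * x) = of_int (int n) * H x"
      using mult[OF x, of "int n"] by auto
    then show False using all[of "of_int (int n) * x"] n by (simp add: abs_mult)
  qed
  then show ?thesis by (auto simp: H_def intro!: exI[of _ c])
qed

text \<open>The open sets of the pullback topology are the preimages under \<open>\<theta>\<close> of open sets, so the preimage of
  \<open>U\<close> under \<open>\<theta> \<circ> f\<close> has to be exhibited as such a preimage; the set \<open>W\<close> is a union of balls so
  small that the Lipschitz bound keeps their images inside \<open>U\<close>.\<close>

lemma continuous_map_pullback_Lipschitz:
  fixes \<theta> :: "'a \<Rightarrow> 'b :: real_normed_vector"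
  assumes f: "f \<in> S \<rightarrow> S"
    and lip: "\<And>x y. x \<in> S \<Longrightarrow> y \<in> S \<Longrightarrow> norm (\<theta> (f x) - \<theta> (f y)) \<le> C * norm (\<theta> x - \<theta> y)"
  shows "continuous_map (pullback_topology S \<theta> euclidean) (pullback_topology S \<theta> euclidean) f"
proof (rule continuous_map_pullback')
  have lip': "norm (\<theta> (f x) - \<theta> (f y)) \<le> (\<bar>C\<bar> + 1) * norm (\<theta> x - \<theta> y)" if "x \<in> S" "y \<in> S" for x y
    by (rule order_trans[OF lip[OF that]]) (simp add: mult_right_mono)
  show "continuous_map (pullback_topology S \<theta> euclidean) euclidean (\<theta> \<circ> f)"
    unfolding continuous_map_def
  proof (intro conjI allI impI)
    fix U :: "'b set" assume "openin euclidean U"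
    then have U: "open U" by simp
    \<comment> \<open>the Lipschitz bound sends a ball of radius \<open>e / (|C| + 1)\<close> into one of radius \<open>e\<close>;
      the \<open>1\<close> keeps the denominator positive\<close>
    define W where "W = \<Union>{ball (\<theta> x) (e / (\<bar>C\<bar> + 1)) | x e. x \<in> S \<and> 0 < e \<and> ball (\<theta> (f x)) e \<subseteq> U}"
    have "open W" unfolding W_def by (rule open_Union) auto
    moreover have "{x \<in> S. (\<theta> \<circ> f) x \<in> U} = \<theta> -` W \<inter> S"
    proof (intro Set.set_eqI iffI)
      fix x assume "x \<in> {x \<in> S. (\<theta> \<circ> f) x \<in> U}"
      then have x: "x \<in> S" "\<theta> (f x) \<in> U" by auto
      then obtain e where "0 < e" "ball (\<theta> (f x)) e \<subseteq> U" using U openE by blast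
      moreover have "\<theta> x \<in> ball (\<theta> x) (e / (\<bar>C\<bar> + 1))" using \<open>0 < e\<close> by (auto intro!: divide_pos_pos)
      ultimately show "x \<in> \<theta> -` W \<inter> S" using x unfolding W_def by blast
    next
      fix y assume "y \<in> \<theta> -` W \<inter> S"
      then obtain x e where y: "y \<in> S" and xe: "x \<in> S" "0 < e" "ball (\<theta> (f x)) e \<subseteq> U"
          "\<theta> y \<in> ball (\<theta> x) (e / (\<bar>C\<bar> + 1))" unfolding W_def by blast
      have pos: "0 < \<bar>C\<bar> + 1" by simp
      have "norm (\<theta> x - \<theta> y) < e / (\<bar>C\<bar> + 1)" using xe(4) by (simp add: dist_norm)
      then have "(\<bar>C\<bar> + 1) * norm (\<theta> x - \<theta> y) < e"
        using pos by (simp add: pos_less_divide_eq mult.commute)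
      then have "\<theta> (f y) \<in> ball (\<theta> (f x)) e"
        using lip'[OF xe(1) y] by (simp add: dist_norm)
      then show "y \<in> {x \<in> S. (\<theta> \<circ> f) x \<in> U}" using xe y by auto
    qed
    ultimately show "openin (pullback_topology S \<theta> euclidean)
       {x \<in> topspace (pullback_topology S \<theta> euclidean). (\<theta> \<circ> f) x \<in> U}"
      by (auto simp: openin_pullback_topology topspace_pullback_topology)
  qed auto
  show "topspace (pullback_topology S \<theta> euclidean) \<subseteq> f -` S"
    using f by (auto simp: topspace_pullback_topology)
qed

section \<open>Powers of an integer matrix acting on rows\<close>

text \<open>The power of a matrix in exactly the form that occurs in \<open>primitive_matrix\<close>; the operation \<open>^\<close>
  on this type is the componentwise power.\<close>

abbreviation mpow :: "int ^ 'n ^ 'n \<Rightarrow> nat \<Rightarrow> int ^ 'n ^ 'n" where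
  "mpow A m \<equiv> ((\<lambda>B. B ** A) ^^ m) (mat 1)"

lemma mpow_commute: "X \<in> commutant A \<Longrightarrow> mpow A m ** X = X ** mpow A m"
  by (induction m) (auto simp: commutant_def, metis matrix_mul_assoc)

lemma mpow_mem_commutant: "mpow A m \<in> commutant A"
  using mpow_commute[of A A m] by (simp add: commutant_def)

lemma mpow_add: "mpow A (m + n) = mpow A m ** mpow A n"
  by (induction n) (simp_all add: matrix_mul_assoc)

lemma row_funpow: "((\<lambda>v. v v* A) ^^ m) v = v v* mpow A m"
  by (induction m) (simp_all add: vector_matrix_mul_assoc)

lemma commutant_funpow:
  assumes "X \<in> commutant A"
  shows "((\<lambda>X. A ** X ** A) ^^ m) X = X ** mpow A (2 * m)"
proof (induction m)
  case (Suc m)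
  have "X ** mpow A (2 * m) \<in> commutant A"
    using assms mpow_mem_commutant commutant_mult by blast
  then have "A ** (X ** mpow A (2 * m)) ** A = X ** mpow A (2 * m) ** A ** A"
    by (simp add: commutant_def)
  then show ?case using Suc by (simp add: matrix_mul_assoc)
qed simp

text \<open>Additive maps on integer vectors are determined by the unit vectors; stated as an induction
  rule so that it applies to maps into groups that are not instances of a type class.\<close>

lemma int_vec_induct:
  fixes v :: "int ^ 'n"
  assumes axis: "\<And>i. Q (axis i 1)" and add: "\<And>v w. Q v \<Longrightarrow> Q w \<Longrightarrow> Q (v + w)"
    and neg: "\<And>v. Q v \<Longrightarrow> Q (- v)"
  shows "Q v"
proof -
  have 0: "Q 0" using add[OF axis neg[OF axis[of undefined]], of undefined] by simp
  have nat: "Q (int n *s axis i 1)" for n i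
    by (induction n) (auto simp: 0 axis add vector_sadd_rdistrib)
  have int: "Q (k *s axis i 1)" for k :: int and i
  proof (cases k)
    case (nonneg n) then show ?thesis using nat by simp
  next
    case (neg n)
    have "k *s axis i 1 = - (int (Suc n) *s axis i (1 :: int))"
      unfolding neg by (simp add: vec_eq_iff)
    then show ?thesis using assms(3)[OF nat[of "Suc n" i]] by metis
  qed
  have "Q (\<Sum>i \<in> I. v $ i *s axis i 1)" for I :: "'n set"
    using finite[of I] by (induction I rule: finite_induct) (auto simp: 0 int add)
  moreover have "(\<Sum>i \<in> UNIV. v $ i *s axis i 1) = v" by (rule basis_expansion)
  ultimately show ?thesis by metis
qed

lemma axis_vector_matrix_mult: "axis i 1 v* X = (X :: int ^ 'n ^ 'n) $ i"
  by (simp add: vector_matrix_mult_def vec_eq_iff axis_def if_distrib[of "\<lambda>x. x * _"] cong: if_cong)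

lemma minus_vector_matrix_mult: "- v v* X = - (v v* (X :: int ^ 'n ^ 'n))"
  by (simp add: vector_matrix_mult_def vec_eq_iff sum_negf)

lemma matrix_eqI_rows:
  fixes X Y :: "int ^ 'n ^ 'n"
  assumes "\<And>i. axis i 1 v* X = axis i 1 v* Y" shows "X = Y"
  using assms by (simp add: axis_vector_matrix_mult vec_eq_iff)

lemma nonneg_vec_mat:
  fixes v :: "int ^ 'n"
  assumes "0 \<le> v" "\<And>i j. 0 \<le> X $ i $ j"
  shows "0 \<le> v v* X"
  using assms by (auto simp: less_eq_vec_def vector_matrix_mult_def intro!: sum_nonneg mult_nonneg_nonneg)

lemma nonneg_mpow:
  assumes "\<And>i j. 0 \<le> A $ i $ j"
  shows "0 \<le> mpow A m $ i $ j"
proof (induction m arbitrary: i j)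
  case (Suc m)
  then show ?case using assms
    by (auto simp: matrix_matrix_mult_def intro!: sum_nonneg mult_nonneg_nonneg)
qed (simp add: mat_def)

section \<open>Positive functionals and the Harnack inequality\<close>

text \<open>A positive homomorphism \<open>h\<close> from the dimension group to the reals, given by its values
  \<open>p N v = h [v, N]\<close> on representatives.\<close>

definition positive_functional :: "int ^ 'n ^ 'n \<Rightarrow> (nat \<Rightarrow> int ^ 'n \<Rightarrow> real) \<Rightarrow> bool" where
  "positive_functional A p \<longleftrightarrow>
     (\<forall>N v w. p N (v + w) = p N v + p N w) \<and>
     (\<forall>N v. p (Suc N) (v v* A) = p N v) \<and>
     (\<forall>N v. 0 \<le> v \<longrightarrow> 0 \<le> p N v)"

text \<open>With \<open>m\<close> such that all entries of the \<open>m\<close>-th power are at least \<open>1\<close>, and \<open>R\<close> an upper bound for them,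
  every coordinate of the image of \<open>v\<close> is a sum of the \<open>v $ i\<close> with weights between \<open>1\<close> and \<open>R\<close>.\<close>

lemma primitive_power_spread:
  fixes A :: "int ^ 'n ^ 'n"
  assumes "primitive_matrix A"
  obtains m R where "0 < R"
    "\<And>v. 0 \<le> v \<Longrightarrow> sum (($) v) UNIV *s 1 \<le> v v* mpow A m"
    "\<And>v. 0 \<le> v \<Longrightarrow> v v* mpow A m \<le> (R * sum (($) v) UNIV) *s 1"
proof -
  obtain m where m: "0 < mpow A m $ i $ j" for i j
    using assms unfolding primitive_matrix_def by blast
  define R where "R = (\<Sum>i \<in> UNIV. \<Sum>j \<in> UNIV. mpow A m $ i $ j)"
  have R: "mpow A m $ i $ j \<le> R" for i j
  proof -
    have "mpow A m $ i $ j \<le> (\<Sum>j \<in> UNIV. mpow A m $ i $ j)"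
      using m by (intro member_le_sum) (auto simp: less_imp_le)
    also have "\<dots> \<le> R" unfolding R_def
      using m by (intro member_le_sum) (auto simp: less_imp_le intro!: sum_nonneg)
    finally show ?thesis .
  qed
  show thesis
  proof
    show "0 < R" using m R less_le_trans by blast
    fix v :: "int ^ 'n" assume "0 \<le> v"
    then have v: "0 \<le> v $ i" for i by (simp add: less_eq_vec_def)
    have "v $ i \<le> v $ i * mpow A m $ i $ j" for i j
      using mult_left_mono[of 1 "mpow A m $ i $ j" "v $ i"] m[of i j] v[of i] by simp
    then show "sum (($) v) UNIV *s 1 \<le> v v* mpow A m"
      unfolding less_eq_vec_def vector_matrix_mult_def by (auto intro!: sum_mono)
    show "v v* mpow A m \<le> (R * sum (($) v) UNIV) *s 1"
      unfolding less_eq_vec_def vector_matrix_mult_def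
      using R v by (auto intro!: sum_mono mult_left_mono simp: sum_distrib_left mult.commute[of R])
  qed
qed

context
  fixes A :: "int ^ 'n ^ 'n" and p
  assumes p: "positive_functional A p"
begin

lemma positive_functional_mono:
  assumes "v \<le> w" shows "p N v \<le> p N w"
proof -
  have "0 \<le> w - v" using assms by (simp add: less_eq_vec_def)
  then have "0 \<le> p N (w - v)" using p by (simp add: positive_functional_def)
  moreover have "p N w = p N (w - v) + p N v"
    using p unfolding positive_functional_def by (metis diff_add_cancel)
  ultimately show ?thesis by simp
qed

lemma positive_functional_shift: "p (N + m) (v v* mpow A m) = p N v"
  using p by (induction m) (simp_all add: positive_functional_def vector_matrix_mul_assoc[symmetric])

lemma positive_functional_scale:
  assumes "0 \<le> k" shows "p N (k *s v) = of_int k * p N v"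
proof -
  have 0: "p N 0 = 0" using p unfolding positive_functional_def by (metis add_0 add_cancel_left_left)
  have "p N (int n *s v) = of_nat n * p N v" for n
    using p by (induction n) (auto simp: 0 positive_functional_def vector_sadd_rdistrib distrib_right)
  then show ?thesis using assms by (cases k) auto
qed

end

text \<open>Spreading \<open>v\<close> over \<open>m\<close> steps shows that \<open>p N v\<close> and \<open>q N v\<close> agree, up to the factor \<open>R\<close>, with
  \<open>|v|\<close> times \<open>P = p (N + m) 1\<close> and \<open>Q = q (N + m) 1\<close>. It remains to bound \<open>Q\<close> by \<open>P\<close> uniformly in \<open>N\<close>.
  For that the fixed element \<open>[w, N0]\<close> is moved to stage \<open>N\<close>: its two values do not change,
  and they are comparable with \<open>|w'| P\<close> and \<open>|w'| Q\<close> for the same unknown factor \<open>|w'|\<close>, which cancels.\<close>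

lemma positive_functional_harnack:
  fixes A :: "int ^ 'n ^ 'n"
  assumes A: "primitive_matrix A" and p: "positive_functional A p" and q: "positive_functional A q"
    and pos: "0 \<le> w" "0 < p N0 w"
  shows "\<exists>C. \<forall>N \<ge> N0. \<forall>v \<ge> 0. q N v \<le> C * p N v"
proof -
  obtain m R where R: "0 < R"
    and lower: "\<And>v. 0 \<le> v \<Longrightarrow> sum (($) v) UNIV *s 1 \<le> v v* mpow A m"
    and upper: "\<And>v. 0 \<le> v \<Longrightarrow> v v* mpow A m \<le> (R * sum (($) v) UNIV) *s 1"
    using primitive_power_spread[OF A] by metis
  have lo: "of_int (sum (($) v) UNIV) * f (N + m) 1 \<le> f N v"
    and up: "f N v \<le> of_int (R * sum (($) v) UNIV) * f (N + m) 1"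
    if f: "positive_functional A f" and v: "0 \<le> v" for f N v
  proof -
    have s: "0 \<le> sum (($) v) UNIV" using v by (auto simp: less_eq_vec_def intro: sum_nonneg)
    show "of_int (sum (($) v) UNIV) * f (N + m) 1 \<le> f N v"
      using positive_functional_mono[OF f lower[OF v], of "N + m"]
      unfolding positive_functional_shift[OF f] positive_functional_scale[OF f s] .
    show "f N v \<le> of_int (R * sum (($) v) UNIV) * f (N + m) 1"
      using positive_functional_mono[OF f upper[OF v], of "N + m"] R s
      unfolding positive_functional_shift[OF f] by (simp add: positive_functional_scale[OF f])
  qed
  have A0: "0 \<le> A $ i $ j" for i j using A by (simp add: primitive_matrix_def)
  show ?thesis
  proof (intro exI allI impI)
    fix N v assume N: "N0 \<le> N" and v: "(0 :: int ^ 'n) \<le> v"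
    define w' where "w' = w v* mpow A (N - N0)"
    have w': "0 \<le> w'" unfolding w'_def by (intro nonneg_vec_mat pos nonneg_mpow A0)
    have f: "f N w' = f N0 w" if "positive_functional A f" for f
      using positive_functional_shift[OF that, of N0 "N - N0" w] N by (simp add: w'_def)
    define s t where "s = real_of_int (sum (($) w') UNIV)" and "t = real_of_int (sum (($) v) UNIV)"
    define P Q where "P = p (N + m) 1" and "Q = q (N + m) 1"
    have s0: "0 \<le> s" unfolding s_def of_int_0_le_iff
      using w' by (auto simp: less_eq_vec_def intro: sum_nonneg)
    have t0: "0 \<le> t" unfolding t_def of_int_0_le_iff
      using v by (auto simp: less_eq_vec_def intro: sum_nonneg)
    have Q0: "0 \<le> q N0 w" using q pos by (simp add: positive_functional_def)
    have 1: "p N0 w \<le> of_int R * s * P" using up[OF p w', of N] f[OF p] by (simp add: s_def P_def)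
    have 2: "s * Q \<le> q N0 w" using lo[OF q w', of N] f[OF q] by (simp add: s_def Q_def)
    have 3: "q N v \<le> of_int R * t * Q" using up[OF q v, of N] by (simp add: t_def Q_def)
    have 4: "t * P \<le> p N v" using lo[OF p v, of N] by (simp add: t_def P_def)
    have R': "0 < real_of_int R" using R by simp
    have spos: "0 < s" using 1 pos(2) s0 by (cases "s = 0") auto
    have "s * (p N0 w * Q) \<le> s * (q N0 w * of_int R * P)"
    proof -
      have "s * (p N0 w * Q) = p N0 w * (s * Q)" by simp
      also have "\<dots> \<le> p N0 w * q N0 w" using 2 pos(2) by simp
      also have "\<dots> \<le> (of_int R * s * P) * q N0 w" using 1 Q0 by (rule mult_right_mono)
      finally show ?thesis by (simp add: algebra_simps)
    qed
    then have "p N0 w * Q \<le> q N0 w * of_int R * P" using spos by simp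
    then have Q: "Q \<le> (of_int R * q N0 w / p N0 w) * P"
      using pos(2) by (simp add: pos_le_divide_eq algebra_simps)
    have "q N v \<le> of_int R * t * ((of_int R * q N0 w / p N0 w) * P)"
      using 3 mult_left_mono[OF Q, of "of_int R * t"] R' t0 by simp
    also have "\<dots> = (of_int R * of_int R * q N0 w / p N0 w) * (t * P)" by simp
    also have "\<dots> \<le> (of_int R * of_int R * q N0 w / p N0 w) * p N v"
      using 4 R' Q0 pos(2) by (intro mult_left_mono) auto
    finally show "q N v \<le> (of_int R * of_int R * q N0 w / p N0 w) * p N v" .
  qed
qed

section \<open>A dense order embedding of the dimension group is one-dimensional\<close>

locale dense_dimension_group =
  fixes A :: "int ^ 'n ^ 'n" and \<theta> :: "((int ^ 'n) \<times> nat) set \<Rightarrow> real ^ 'k"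
  assumes primitive: "primitive_matrix A"
    and embedding: "order_embedding (dimension_group A) \<theta>"
    and dense: "closure (\<theta> ` carrier (dimension_group A)) = UNIV"
begin

abbreviation "G \<equiv> dimension_group A"
abbreviation "E \<equiv> continuous_End G \<theta>"
abbreviation "R \<equiv> homoclinic_K0_ring A"

sublocale rows: stationary_system UNIV "\<lambda>v. v v* A"
  by (rule stationary_system_rows)

sublocale comm: stationary_system "commutant A" "\<lambda>X. A ** X ** A"
  by (rule stationary_system_commutant)

sublocale comm_group G
  by (rule comm_group_dimension_group)

lemma carrier_G: "carrier G = ilim UNIV (\<lambda>v. v v* A)"
  by (simp add: dimension_group_def Let_def)

lemma class_carrier [simp]: "rows.cls v N \<in> carrier G"
  by (simp add: carrier_G rows.class_mem)

lemma class_cases: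
  assumes "g \<in> carrier G" obtains v N where "g = rows.cls v N"
  using assms rows.ilim_cases unfolding carrier_G by metis

lemma class_mult: "rows.cls v N \<otimes>\<^bsub>G\<^esub> rows.cls w N = rows.cls (v + w) N"
  by (simp add: dimension_group_def Let_def rows.ilim_add_class)

lemma class_shift: "rows.cls (v v* mpow A m) (N + m) = rows.cls v N"
  using rows.class_shift[of v m N] by (simp add: row_funpow)

lemma class_eqD:
  assumes "rows.cls v N = rows.cls w N"
  shows "\<exists>m. v v* mpow A m = w v* mpow A m"
  using assms by (auto simp: rows.class_eq_iff row_funpow)

lemma positive_class: "0 \<le> v \<Longrightarrow> rows.cls v N \<in> positive_cone G"
  by (simp add: dimension_group_def Let_def less_eq_vec_def) (metis funpow_0)

text \<open>Positive elements have non-negative representatives at arbitrarily late stages, which is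
  where the Harnack inequality applies.\<close>

lemma positive_cases:
  assumes "g \<in> positive_cone G"
  obtains v N where "N0 \<le> N" "0 \<le> v" "g = rows.cls v N"
proof -
  obtain v N m where g: "g = rows.cls v N" "0 \<le> v v* mpow A m"
    using assms by (auto simp: dimension_group_def Let_def row_funpow less_eq_vec_def)
  have A0: "0 \<le> A $ i $ j" for i j using primitive by (simp add: primitive_matrix_def)
  have "0 \<le> v v* mpow A m v* mpow A N0"
    using g(2) by (rule nonneg_vec_mat) (intro nonneg_mpow A0)
  moreover have "g = rows.cls (v v* mpow A m v* mpow A N0) (N + m + N0)"
    by (simp add: class_shift g)
  ultimately show thesis using that[of "N + m + N0"] by simp
qed

lemma theta_mult: "g \<in> carrier G \<Longrightarrow> h \<in> carrier G \<Longrightarrow> \<theta> (g \<otimes>\<^bsub>G\<^esub> h) = \<theta> g + \<theta> h"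
  using embedding by (simp add: order_embedding_def)

lemma coordinate_functional: "positive_functional A (\<lambda>N v. \<theta> (rows.cls v N) $ i)"
  unfolding positive_functional_def
proof (intro conjI allI impI)
  show "\<theta> (rows.cls (v + w) N) $ i = \<theta> (rows.cls v N) $ i + \<theta> (rows.cls w N) $ i" for N v w
    using theta_mult[of "rows.cls v N" "rows.cls w N"] by (simp add: class_mult)
  show "\<theta> (rows.cls (v v* A) (Suc N)) $ i = \<theta> (rows.cls v N) $ i" for N v
    using class_shift[of v 1 N] by simp
  show "0 \<le> \<theta> (rows.cls v N) $ i" if "0 \<le> v" for N v
    using embedding positive_class[OF that, of N] by (simp add: order_embedding_def)
qed

lemma theta_approx:
  assumes "0 < e"
  obtains g where "g \<in> carrier G" "\<And>i. \<bar>\<theta> g $ i - y $ i\<bar> < e"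
proof -
  have "y \<in> closure (\<theta> ` carrier G)" using dense by simp
  then obtain g where g: "g \<in> carrier G" "dist (\<theta> g) y < e"
    using assms unfolding closure_approachable by blast
  have "\<bar>\<theta> g $ i - y $ i\<bar> < e" for i
    using component_le_norm_cart[of "\<theta> g - y" i] g(2) by (simp add: dist_norm)
  with g(1) show thesis by (rule that)
qed

lemma strictly_positive_stage:
  obtains w N where "0 \<le> w" "\<And>i. 0 < \<theta> (rows.cls w N) $ i"
proof -
  obtain g where g: "g \<in> carrier G" "\<And>i. \<bar>\<theta> g $ i - (\<chi> i. 1) $ i\<bar> < 1"
    using theta_approx[of 1 "\<chi> i. 1"] by auto
  have pos: "0 < \<theta> g $ i" for i using g(2)[of i] by (simp add: abs_if split: if_splits)
  then have "g \<in> positive_cone G"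
    using g(1) embedding by (simp add: order_embedding_def less_imp_le)
  then obtain w N where "0 \<le> w" "g = rows.cls w N" using positive_cases[of g 0] by metis
  then show thesis using that pos by blast
qed

text \<open>Density gives a positive element whose \<open>j\<close>-th coordinate is much larger than its \<open>i\<close>-th one. This
  contradicts the Harnack inequality for the two coordinates as positive functionals.\<close>

lemma coordinate_unique: "(i :: 'k) = j"
proof (rule ccontr)
  assume ij: "i \<noteq> j"
  obtain w N0 where w: "0 \<le> w" "\<And>i. 0 < \<theta> (rows.cls w N0) $ i" using strictly_positive_stage by metis
  obtain C where C: "\<And>N v. N0 \<le> N \<Longrightarrow> 0 \<le> v \<Longrightarrow> \<theta> (rows.cls v N) $ j \<le> C * \<theta> (rows.cls v N) $ i"
    using positive_functional_harnack[OF primitive coordinate_functional coordinate_functional w(1) w(2)[of i]] by metis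
  \<comment> \<open>near \<open>y\<close> the coordinate \<open>j\<close> exceeds \<open>C\<close> times the coordinate \<open>i\<close>, even with errors up to \<open>1 / 2\<close>\<close>
  define y :: "real ^ 'k" where "y = (\<chi> l. if l = i then 1 else 2 * \<bar>C\<bar> + 2)"
  obtain g where g: "g \<in> carrier G" "\<And>l. \<bar>\<theta> g $ l - y $ l\<bar> < 1 / 2"
    using theta_approx[of "1 / 2" y] by auto
  have "0 \<le> \<theta> g $ l" for l
    using g(2)[of l] by (simp add: y_def abs_if split: if_splits)
  then have "g \<in> positive_cone G"
    using g(1) embedding by (simp add: order_embedding_def)
  then obtain v N where "N0 \<le> N" "0 \<le> v" "g = rows.cls v N" by (rule positive_cases)
  then have le: "\<theta> g $ j \<le> C * \<theta> g $ i" using C by simp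
  have gi: "0 \<le> \<theta> g $ i" "\<theta> g $ i \<le> 3 / 2" using g(2)[of i] by (simp_all add: y_def abs_if split: if_splits)
  have gj: "2 * \<bar>C\<bar> + 3 / 2 < \<theta> g $ j" using g(2)[of j] ij by (auto simp: y_def abs_if split: if_splits)
  have "C * \<theta> g $ i \<le> \<bar>C\<bar> * (3 / 2)"
    using gi by (intro mult_mono) auto
  then show False using le gj by linarith
qed

text \<open>The only coordinate of \<open>\<theta>\<close>; by \<open>coordinate_unique\<close> every index names it, so \<open>undefined\<close> is as good as any.\<close>

definition \<tau> :: "((int ^ 'n) \<times> nat) set \<Rightarrow> real" where "\<tau> g = \<theta> g $ undefined"

lemma theta_coordinate: "\<theta> g $ i = \<tau> g"
  using coordinate_unique[of i undefined] by (simp add: \<tau>_def)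

lemma norm_one_coordinate: "norm (x :: real ^ 'k) = \<bar>x $ i\<bar>"
proof -
  have "UNIV = {i}" using coordinate_unique by blast
  then have "norm x = L2_set (\<lambda>i. norm (x $ i)) {i}" unfolding norm_vec_def by (rule arg_cong)
  then show ?thesis by simp
qed

lemma tau_inj: "g \<in> carrier G \<Longrightarrow> h \<in> carrier G \<Longrightarrow> \<tau> g = \<tau> h \<Longrightarrow> g = h"
  using embedding by (auto simp: order_embedding_def inj_on_def vec_eq_iff theta_coordinate)

lemma tau_mult: "g \<in> carrier G \<Longrightarrow> h \<in> carrier G \<Longrightarrow> \<tau> (g \<otimes>\<^bsub>G\<^esub> h) = \<tau> g + \<tau> h"
  by (simp add: \<tau>_def theta_mult)

lemma tau_one: "\<tau> \<one>\<^bsub>G\<^esub> = 0"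
  using tau_mult[of "\<one>\<^bsub>G\<^esub>" "\<one>\<^bsub>G\<^esub>"] by simp

lemma tau_inv: "g \<in> carrier G \<Longrightarrow> \<tau> (inv\<^bsub>G\<^esub> g) = - \<tau> g"
  using tau_mult[of g "inv\<^bsub>G\<^esub> g"] by (simp add: tau_one)

lemma tau_positive: "g \<in> carrier G \<Longrightarrow> g \<in> positive_cone G \<longleftrightarrow> 0 \<le> \<tau> g"
  using embedding by (simp add: order_embedding_def theta_coordinate)

lemma tau_class_add: "\<tau> (rows.cls (v + w) N) = \<tau> (rows.cls v N) + \<tau> (rows.cls w N)"
  by (metis class_mult class_carrier tau_mult)

lemma tau_class_minus: "\<tau> (rows.cls (- v) N) = - \<tau> (rows.cls v N)"
proof -
  have "\<tau> (rows.cls 0 N) = 0" using tau_class_add[of 0 0 N] by simp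
  then show ?thesis using tau_class_add[of v "- v" N] by simp
qed

lemma tau_functional: "positive_functional A (\<lambda>N v. \<tau> (rows.cls v N))"
  unfolding \<tau>_def by (rule coordinate_functional)

lemma tau_dense: "closure (\<tau> ` carrier G) = UNIV"
proof -
  have "y \<in> closure (\<tau> ` carrier G)" for y
    unfolding closure_approachable
  proof (intro allI impI)
    fix e :: real assume "0 < e"
    then obtain g where "g \<in> carrier G" "\<And>i. \<bar>\<theta> g $ i - (\<chi> i. y) $ i\<bar> < e"
      using theta_approx[of e "\<chi> i. y"] by auto
    then show "\<exists>x \<in> \<tau> ` carrier G. dist x y < e" by (auto simp: theta_coordinate dist_real_def)
  qed
  then show ?thesis by blast
qed

section \<open>Continuous endomorphisms are multiplications by scalars\<close>

lemma carrier_E: "f \<in> carrier E \<longleftrightarrow> f \<in> hom G G \<and> f \<in> extensional (carrier G) \<and>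
    continuous_map (pullback_topology (carrier G) \<theta> euclidean) (pullback_topology (carrier G) \<theta> euclidean) f"
  by (auto simp: continuous_End_def Let_def)

text \<open>Transport \<open>f\<close> along \<open>\<tau>\<close> to an additive map on the dense subgroup \<open>\<tau> ` carrier G\<close> of the line.
  Continuity enters at the neutral element only, as boundedness near \<open>0\<close>.\<close>

lemma continuous_End_scalar:
  assumes "f \<in> carrier E"
  shows "\<exists>c. \<forall>g \<in> carrier G. \<tau> (f g) = c * \<tau> g"
proof -
  let ?T = "pullback_topology (carrier G) \<theta> euclidean"
  have hom: "f g \<in> carrier G" "f (g \<otimes>\<^bsub>G\<^esub> h) = f g \<otimes>\<^bsub>G\<^esub> f h" if "g \<in> carrier G" "h \<in> carrier G" for g h
    using assms that by (auto simp: carrier_E hom_def)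
  have cont: "continuous_map ?T ?T f" using assms by (simp add: carrier_E)
  define F where "F x = \<tau> (f (inv_into (carrier G) \<tau> x))" for x
  have inj: "inj_on \<tau> (carrier G)" using tau_inj by (auto simp: inj_on_def)
  have F: "F (\<tau> g) = \<tau> (f g)" if "g \<in> carrier G" for g
    using that by (simp add: F_def inv_into_f_f[OF inj])
  let ?V = "\<theta> -` {x. \<bar>x $ undefined\<bar> < 1} \<inter> carrier G"
  have "open {x :: real ^ 'k. \<bar>x $ undefined\<bar> < 1}"
    by (intro open_Collect_less continuous_intros)
  then have "openin ?T ?V" by (auto simp: openin_pullback_topology)
  then have "openin ?T {g \<in> topspace ?T. f g \<in> ?V}"
    using cont by (rule openin_continuous_map_preimage[rotated])
  then obtain W where W: "open W" "{g \<in> topspace ?T. f g \<in> ?V} = \<theta> -` W \<inter> carrier G"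
    by (auto simp: openin_pullback_topology)
  have f1: "f \<one>\<^bsub>G\<^esub> = \<one>\<^bsub>G\<^esub>"
    using tau_inj[of "f \<one>\<^bsub>G\<^esub>" "\<one>\<^bsub>G\<^esub>"] hom[of "\<one>\<^bsub>G\<^esub>" "\<one>\<^bsub>G\<^esub>"] tau_mult[of "f \<one>\<^bsub>G\<^esub>" "f \<one>\<^bsub>G\<^esub>"]
    by (simp add: tau_one)
  have t1: "\<theta> \<one>\<^bsub>G\<^esub> = 0" by (simp add: vec_eq_iff theta_coordinate tau_one)
  have "\<one>\<^bsub>G\<^esub> \<in> {g \<in> topspace ?T. f g \<in> ?V}"
    by (simp add: topspace_pullback_topology f1 t1)
  then have "0 \<in> W" unfolding W(2) by (simp add: t1)
  then obtain \<delta> where \<delta>: "0 < \<delta>" "ball 0 \<delta> \<subseteq> W" using W(1) openE by blast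
  have "\<exists>c. \<forall>x \<in> \<tau> ` carrier G. F x = c * x"
  proof (rule additive_dense_linear)
    show "0 \<in> \<tau> ` carrier G" using tau_one by (metis imageI one_closed)
    show "x + y \<in> \<tau> ` carrier G" if "x \<in> \<tau> ` carrier G" "y \<in> \<tau> ` carrier G" for x y
      using that by (auto simp: tau_mult[symmetric])
    show "- x \<in> \<tau> ` carrier G" if "x \<in> \<tau> ` carrier G" for x
      using that by (auto simp: tau_inv[symmetric])
    show "F (x + y) = F x + F y" if xy: "x \<in> \<tau> ` carrier G" "y \<in> \<tau> ` carrier G" for x y
    proof -
      obtain g h where "g \<in> carrier G" "h \<in> carrier G" "x = \<tau> g" "y = \<tau> h" using xy by auto
      then show ?thesis using F[of "g \<otimes>\<^bsub>G\<^esub> h"] by (simp add: tau_mult F hom)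
    qed
    show "closure (\<tau> ` carrier G) = UNIV" by (rule tau_dense)
    show "0 < \<delta>" by (rule \<delta>)
    show "\<bar>F x\<bar> \<le> 1" if x: "x \<in> \<tau> ` carrier G" "\<bar>x\<bar> < \<delta>" for x
    proof -
      obtain g where g: "g \<in> carrier G" "x = \<tau> g" using x(1) by auto
      have "norm (\<theta> g) < \<delta>" using x(2) g norm_one_coordinate[of "\<theta> g"] by (simp add: theta_coordinate)
      then have "g \<in> \<theta> -` W \<inter> carrier G" using \<delta>(2) g(1) by auto
      then have "f g \<in> ?V" unfolding W(2)[symmetric] by blast
      then show ?thesis using g F by (simp add: theta_coordinate)
    qed
  qed
  then show ?thesis using F by auto
qed

lemma continuous_End_commute:
  assumes "f \<in> carrier E" "f' \<in> carrier E" "g \<in> carrier G"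
  shows "f (f' g) = f' (f g)"
proof (rule tau_inj)
  have cl: "h x \<in> carrier G" if "h \<in> carrier E" "x \<in> carrier G" for h x
    using that by (auto simp: carrier_E hom_def)
  show "f (f' g) \<in> carrier G" "f' (f g) \<in> carrier G" using assms cl by blast+
  obtain c c' where "\<forall>g \<in> carrier G. \<tau> (f g) = c * \<tau> g" "\<forall>g \<in> carrier G. \<tau> (f' g) = c' * \<tau> g"
    using assms(1,2) continuous_End_scalar by blast
  then show "\<tau> (f (f' g)) = \<tau> (f' (f g))"
    using assms cl by simp
qed

lemma bounded_hom_continuous:
  assumes f: "f \<in> hom G G" "f \<in> extensional (carrier G)"
    and C: "\<And>g. g \<in> carrier G \<Longrightarrow> \<bar>\<tau> (f g)\<bar> \<le> C * \<bar>\<tau> g\<bar>"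
  shows "f \<in> carrier E"
proof -
  have hom: "f g \<in> carrier G" "f (g \<otimes>\<^bsub>G\<^esub> h) = f g \<otimes>\<^bsub>G\<^esub> f h" if "g \<in> carrier G" "h \<in> carrier G" for g h
    using f that by (auto simp: hom_def)
  have "norm (\<theta> (f g) - \<theta> (f h)) \<le> C * norm (\<theta> g - \<theta> h)" if g: "g \<in> carrier G" and h: "h \<in> carrier G" for g h
  proof -
    have fh: "\<tau> (f (inv\<^bsub>G\<^esub> h)) = - \<tau> (f h)"
    proof -
      have "\<tau> (f \<one>\<^bsub>G\<^esub>) = 0"
        using hom[of "\<one>\<^bsub>G\<^esub>" "\<one>\<^bsub>G\<^esub>"] tau_mult[of "f \<one>\<^bsub>G\<^esub>" "f \<one>\<^bsub>G\<^esub>"] by simp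
      then show ?thesis
        using hom[of h "inv\<^bsub>G\<^esub> h"] tau_mult[of "f h" "f (inv\<^bsub>G\<^esub> h)"] h hom(1)[of "inv\<^bsub>G\<^esub> h" h] by simp
    qed
    have "\<tau> (f (g \<otimes>\<^bsub>G\<^esub> inv\<^bsub>G\<^esub> h)) = \<tau> (f g) - \<tau> (f h)"
      using g h by (simp add: hom tau_mult fh)
    moreover have "\<tau> (g \<otimes>\<^bsub>G\<^esub> inv\<^bsub>G\<^esub> h) = \<tau> g - \<tau> h" using g h by (simp add: tau_mult tau_inv)
    ultimately have "\<bar>\<tau> (f g) - \<tau> (f h)\<bar> \<le> C * \<bar>\<tau> g - \<tau> h\<bar>"
      using C[of "g \<otimes>\<^bsub>G\<^esub> inv\<^bsub>G\<^esub> h"] g h by simp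
    then show ?thesis by (simp add: norm_one_coordinate[of _ undefined] theta_coordinate)
  qed
  then show ?thesis
    using f hom(1) by (auto simp: carrier_E intro!: continuous_map_pullback_Lipschitz)
qed

end

section \<open>The ring acts by continuous endomorphisms\<close>

text \<open>A large multiple of a strictly positive power of \<open>A\<close> dominates \<open>X\<close> entrywise and commutes with
  \<open>A\<close>. Thus \<open>X = (X + Z) - Z\<close> is a difference of non-negative matrices in the commutant.\<close>

lemma commutant_dominated:
  fixes A :: "int ^ 'n ^ 'n"
  assumes A: "primitive_matrix A" and X: "X \<in> commutant A"
  obtains Z where "Z \<in> commutant A" "\<And>i j. 0 \<le> Z $ i $ j" "\<And>i j. 0 \<le> (X + Z) $ i $ j"
proof -
  obtain m where m: "0 < mpow A m $ i $ j" for i j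
    using A unfolding primitive_matrix_def by blast
  define c where "c = (\<Sum>i \<in> UNIV. \<Sum>j \<in> UNIV. \<bar>X $ i $ j\<bar>)"
  have c: "\<bar>X $ i $ j\<bar> \<le> c" for i j
  proof -
    have "\<bar>X $ i $ j\<bar> \<le> (\<Sum>j \<in> UNIV. \<bar>X $ i $ j\<bar>)" by (intro member_le_sum) auto
    also have "\<dots> \<le> c" unfolding c_def by (intro member_le_sum) (auto intro!: sum_nonneg)
    finally show ?thesis .
  qed
  define Z :: "int ^ 'n ^ 'n" where "Z = (\<chi> i j. c * mpow A m $ i $ j)"
  show thesis
  proof
    have "(\<Sum>k \<in> UNIV. A $ i $ k * mpow A m $ k $ j) = (\<Sum>k \<in> UNIV. mpow A m $ i $ k * A $ k $ j)" for i j
      using mpow_mem_commutant[of m A] by (simp add: commutant_def matrix_matrix_mult_def vec_eq_iff)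
    then show "Z \<in> commutant A"
      by (simp add: commutant_def Z_def matrix_matrix_mult_def vec_eq_iff mult.left_commute[of _ c]
          mult.assoc sum_distrib_left[symmetric])
    show "0 \<le> Z $ i $ j" for i j
      using c[of i j] m[of i j] by (auto simp: Z_def intro!: mult_nonneg_nonneg)
    show "0 \<le> (X + Z) $ i $ j" for i j
    proof -
      have "c * 1 \<le> c * mpow A m $ i $ j"
        using c[of i j] m[of i j] by (intro mult_left_mono) auto
      then show ?thesis using c[of i j] by (simp add: Z_def)
    qed
  qed
qed

context dense_dimension_group
begin

text \<open>The action \<open>[v, M] \<mapsto> [v X, M + 2 N]\<close> of \<open>[X, N]\<close>. The union runs over all representatives, which all
  yield the same class (\<open>act_class\<close>); extensionality is part of membership in the endomorphism ring.\<close>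

definition act :: "((int ^ 'n ^ 'n) \<times> nat) set \<Rightarrow> ((int ^ 'n) \<times> nat) set \<Rightarrow> ((int ^ 'n) \<times> nat) set" where
  "act U = (\<lambda>g \<in> carrier G. \<Union>(X, N) \<in> U. \<Union>(v, M) \<in> g. rows.cls (v v* X) (M + 2 * N))"

lemma act_class:
  assumes X: "X \<in> commutant A"
  shows "act (comm.cls X N) (rows.cls v M) = rows.cls (v v* X) (M + 2 * N)"
proof -
  have eq: "rows.cls (v' v* X') (M' + 2 * N') = rows.cls (v v* X) (M + 2 * N)"
    if X'N': "(X', N') \<in> comm.cls X N" and v'M': "(v', M') \<in> rows.cls v M" for X' N' v' M'
  proof -
    obtain L where L: "N \<le> L" "N' \<le> L" "X ** mpow A (2 * (L - N)) = X' ** mpow A (2 * (L - N'))"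
        and X': "X' \<in> commutant A"
      using X'N' X by (auto simp: comm.mem_class_iff ilim_rel_def commutant_funpow)
    obtain L' where L': "M \<le> L'" "M' \<le> L'" "v v* mpow A (L' - M) = v' v* mpow A (L' - M')"
      using v'M' by (auto simp: rows.mem_class_iff ilim_rel_def row_funpow)
    have cls: "rows.cls (u v* Y) (J + 2 * K) =
        rows.cls (u v* mpow A (L' - J) v* (Y ** mpow A (2 * (L - K)))) (L' + 2 * L)"
      if "Y \<in> commutant A" "J \<le> L'" "K \<le> L" for u Y J K
    proof -
      have "u v* mpow A (L' - J) v* (Y ** mpow A (2 * (L - K)))
          = u v* Y v* mpow A ((L' - J) + 2 * (L - K))"
        unfolding vector_matrix_mul_assoc mpow_add matrix_mul_assoc
        using mpow_commute[OF that(1)] by simp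
      moreover have "L' + 2 * L = J + 2 * K + ((L' - J) + 2 * (L - K))" using that by simp
      ultimately show ?thesis by (simp only: class_shift)
    qed
    show ?thesis
      using cls[OF X L'(1) L(1), of v] cls[OF X' L'(2) L(2), of v'] L(3) L'(3) by simp
  qed
  have "(X, N) \<in> comm.cls X N" "(v, M) \<in> rows.cls v M"
    using X by (auto simp: comm.mem_class_iff rows.mem_class_iff ilim_rel_def)
  then have "(\<Union>(X', N') \<in> comm.cls X N. \<Union>(v', M') \<in> rows.cls v M. rows.cls (v' v* X') (M' + 2 * N'))
      = rows.cls (v v* X) (M + 2 * N)" (is "?U = ?V")
  proof (intro equalityI)
    show "?U \<subseteq> ?V" using eq by fast
  qed fast
  then show ?thesis by (simp add: act_def)
qed

text \<open>For \<open>Y \<ge> 0\<close> the map \<open>\<tau> \<circ> act [Y, N]\<close> is again a positive homomorphism, so Harnack bounds it by a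
  multiple of \<open>\<tau>\<close> on the positive cone. Since \<open>\<tau>\<close> makes the order total, every element or its negative is
  positive.\<close>

lemma act_bounded_nonneg:
  assumes Y: "Y \<in> commutant A" "\<And>i j. 0 \<le> Y $ i $ j"
  shows "\<exists>C. \<forall>g \<in> carrier G. \<bar>\<tau> (act (comm.cls Y N) g)\<bar> \<le> C * \<bar>\<tau> g\<bar>"
proof -
  define q where "q M v = \<tau> (rows.cls (v v* Y) (M + 2 * N))" for M v
  have q: "positive_functional A q"
    unfolding positive_functional_def
  proof (intro conjI allI impI)
    show "q M (v + w) = q M v + q M w" for M v w
      by (simp add: q_def vector_matrix_left_distrib tau_class_add)
    show "q (Suc M) (v v* A) = q M v" for M v
    proof -
      have "v v* A v* Y = v v* Y v* mpow A 1"
        using Y(1) by (simp add: vector_matrix_mul_assoc commutant_def)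
      then show ?thesis using class_shift[of "v v* Y" 1 "M + 2 * N"] by (simp add: q_def)
    qed
    show "0 \<le> q M v" if "0 \<le> v" for M v
      using tau_functional nonneg_vec_mat[OF that Y(2)] by (simp add: positive_functional_def q_def)
  qed
  obtain w N0 where w: "0 \<le> w" "0 < \<tau> (rows.cls w N0)"
    using strictly_positive_stage by (metis theta_coordinate)
  obtain C where C: "\<And>M v. N0 \<le> M \<Longrightarrow> 0 \<le> v \<Longrightarrow> q M v \<le> C * \<tau> (rows.cls v M)"
    using positive_functional_harnack[OF primitive tau_functional q w] by metis
  have bound: "\<bar>\<tau> (act (comm.cls Y N) g)\<bar> \<le> C * \<tau> g" if pos: "g \<in> positive_cone G" for g
  proof -
    obtain v M where g: "N0 \<le> M" "0 \<le> v" "g = rows.cls v M" using pos by (rule positive_cases)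
    have "0 \<le> q M v" using q g(2) by (simp add: positive_functional_def)
    then show ?thesis using C[OF g(1,2)] by (simp add: g(3) act_class Y(1) q_def)
  qed
  have "\<bar>\<tau> (act (comm.cls Y N) g)\<bar> \<le> C * \<bar>\<tau> g\<bar>" if g: "g \<in> carrier G" for g
  proof (cases "0 \<le> \<tau> g")
    case True
    then show ?thesis using bound[of g] g tau_positive by simp
  next
    case False
    obtain v M where v: "g = rows.cls v M" using g by (rule class_cases)
    have neg: "\<tau> (rows.cls (- v) M) = - \<tau> g" by (simp add: v tau_class_minus)
    have "\<tau> (act (comm.cls Y N) (rows.cls (- v) M)) = - \<tau> (act (comm.cls Y N) g)"
      by (simp add: v act_class Y(1) tau_class_minus minus_vector_matrix_mult)
    then show ?thesis
      using bound[of "rows.cls (- v) M"] tau_positive[of "rows.cls (- v) M"] neg False by simp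
  qed
  then show ?thesis by blast
qed

lemma carrier_R: "carrier R = ilim (commutant A) (\<lambda>X. A ** X ** A)"
  by (simp add: homoclinic_K0_ring_def Let_def)

lemma act_mem:
  assumes "U \<in> carrier R" shows "act U \<in> carrier E"
proof -
  obtain X N where X: "X \<in> commutant A" and U: "U = comm.cls X N"
    using assms unfolding carrier_R by (rule comm.ilim_cases)
  obtain Z where Z: "Z \<in> commutant A" "\<And>i j. 0 \<le> Z $ i $ j" "\<And>i j. 0 \<le> (X + Z) $ i $ j"
    using commutant_dominated[OF primitive X] by metis
  have XZ: "X + Z \<in> commutant A" using X Z(1) by (rule comm.add_mem)
  obtain C where C: "\<And>g. g \<in> carrier G \<Longrightarrow> \<bar>\<tau> (act (comm.cls Z N) g)\<bar> \<le> C * \<bar>\<tau> g\<bar>"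
    using act_bounded_nonneg[OF Z(1,2), of N] by blast
  obtain D where D: "\<And>g. g \<in> carrier G \<Longrightarrow> \<bar>\<tau> (act (comm.cls (X + Z) N) g)\<bar> \<le> D * \<bar>\<tau> g\<bar>"
    using act_bounded_nonneg[OF XZ Z(3), of N] by blast
  show ?thesis
  proof (rule bounded_hom_continuous)
    have "act U g \<in> carrier G" if "g \<in> carrier G" for g
      using that by (auto elim!: class_cases simp: U act_class X)
    moreover have "act U (g \<otimes>\<^bsub>G\<^esub> h) = act U g \<otimes>\<^bsub>G\<^esub> act U h" if "g \<in> carrier G" "h \<in> carrier G" for g h
      using that that(2) unfolding carrier_G
      by (rule rows.ilim_cases3) (simp add: U act_class X class_mult vector_matrix_left_distrib)
    ultimately show "act U \<in> hom G G" by (simp add: hom_def)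
    show "act U \<in> extensional (carrier G)" by (simp add: act_def)
    show "\<bar>\<tau> (act U g)\<bar> \<le> (C + D) * \<bar>\<tau> g\<bar>" if g: "g \<in> carrier G" for g
    proof -
      obtain v M where v: "g = rows.cls v M" using g by (rule class_cases)
      have "\<tau> (act (comm.cls (X + Z) N) g) = \<tau> (act U g) + \<tau> (act (comm.cls Z N) g)"
        by (simp add: v U act_class X Z(1) XZ vector_matrix_mult_add_rdistrib tau_class_add)
      then show ?thesis using C[OF g] D[OF g] by (simp add: distrib_right)
    qed
  qed
qed

section \<open>The action is an isomorphism\<close>

text \<open>Each unit vector needs some number of further steps until its two images agree; the maximum of these
  finitely many numbers serves for all rows at once.\<close>

lemma matrices_agree_later:
  fixes X Y :: "int ^ 'n ^ 'n"
  assumes "\<And>v. rows.cls (v v* X) L = rows.cls (v v* Y) L"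
  shows "\<exists>m. X ** mpow A m = Y ** mpow A m"
proof -
  have "\<exists>m. axis i 1 v* X v* mpow A m = axis i 1 v* Y v* mpow A m" for i
    using class_eqD[OF assms] by blast
  then obtain m where m: "\<And>i. axis i 1 v* X v* mpow A (m i) = axis i 1 v* Y v* mpow A (m i)" by metis
  define M where "M = Max (range m)"
  have "axis i 1 v* (X ** mpow A M) = axis i 1 v* (Y ** mpow A M)" for i
  proof -
    have "M = m i + (M - m i)" by (simp add: M_def)
    then have "mpow A M = mpow A (m i) ** mpow A (M - m i)" using mpow_add by metis
    then show ?thesis using m[of i] by (simp only: vector_matrix_mul_assoc[symmetric])
  qed
  then have "X ** mpow A M = Y ** mpow A M" by (rule matrix_eqI_rows)
  then show ?thesis ..
qed

lemma act_inj: "inj_on act (carrier R)"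
proof (rule inj_onI)
  fix U V assume U: "U \<in> carrier R" and V: "V \<in> carrier R" and eq: "act U = act V"
  obtain X Y N where XY: "X \<in> commutant A" "Y \<in> commutant A" "U = comm.cls X N" "V = comm.cls Y N"
    using U V V unfolding carrier_R by (rule comm.ilim_cases3)
  have "rows.cls (v v* X) (2 * N) = rows.cls (v v* Y) (2 * N)" for v
    using fun_cong[OF eq, of "rows.cls v 0"] XY by (simp add: act_class)
  then obtain m where m: "X ** mpow A m = Y ** mpow A m" using matrices_agree_later by blast
  have "X ** mpow A (2 * m) = Y ** mpow A (2 * m)"
    using m by (simp add: mult_2 mpow_add matrix_mul_assoc)
  then show "U = V"
    unfolding XY comm.class_eq_iff[OF XY(1,2)]
    by (intro exI[of _ "N + m"]) (simp add: commutant_funpow XY)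
qed

text \<open>The rows \<open>w i\<close> of \<open>X\<close> represent the values of \<open>f\<close> on the unit vectors of stage \<open>0\<close>, at a common
  stage \<open>L\<close>. As \<open>f\<close> commutes with the shift \<open>S\<close>, the matrices \<open>A X\<close> and \<open>X A\<close> agree after \<open>m\<close> more steps,
  so a later representative \<open>Y\<close> commutes with \<open>A\<close>. Its class \<open>U\<close> acts as \<open>f\<close> on stage \<open>0\<close>, and on the later
  stages by induction, because \<open>S\<close> is injective and sends stage \<open>M + 1\<close> back to stage \<open>M\<close>.\<close>

lemma act_surj:
  assumes f: "f \<in> carrier E"
  shows "f \<in> act ` carrier R"
proof -
  have f_closed: "f g \<in> carrier G" if "g \<in> carrier G" for g
    using f that by (auto simp: carrier_E hom_def)
  have f_mult: "f (g \<otimes>\<^bsub>G\<^esub> h) = f g \<otimes>\<^bsub>G\<^esub> f h" if "g \<in> carrier G" "h \<in> carrier G" for g h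
    using f that by (auto simp: carrier_E hom_def)
  have f_minus: "\<tau> (f (rows.cls (- v) M)) = - \<tau> (f (rows.cls v M))" for v M
    using continuous_End_scalar[OF f] by (auto simp: tau_class_minus)
  have "\<exists>N. \<forall>L \<ge> N. \<exists>w. f (rows.cls (axis i 1) 0) = rows.cls w L" for i
    using rows.ilim_stage[of "f (rows.cls (axis i 1) 0)"] f_closed[of "rows.cls (axis i 1) 0"]
    by (simp add: carrier_G[symmetric])
  then obtain N where N: "\<And>i L. N i \<le> L \<Longrightarrow> \<exists>w. f (rows.cls (axis i 1) 0) = rows.cls w L" by metis
  define L where "L = Max (range N)"
  have "\<exists>w. f (rows.cls (axis i 1) 0) = rows.cls w L" for i
    by (rule N) (simp add: L_def)
  then obtain w where w: "\<And>i. f (rows.cls (axis i 1) 0) = rows.cls (w i) L" by metis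
  define X :: "int ^ 'n ^ 'n" where "X = (\<chi> i. w i)"
  have X: "f (rows.cls v 0) = rows.cls (v v* X) L" for v
  proof (induction v rule: int_vec_induct)
    case (1 i)
    show ?case by (simp add: w X_def axis_vector_matrix_mult)
  next
    case (2 v w)
    then show ?case
      using f_mult[of "rows.cls v 0" "rows.cls w 0"]
      by (simp add: class_mult vector_matrix_left_distrib)
  next
    case (3 v)
    then show ?case
      using f_minus[of v 0] f_closed
      by (intro tau_inj) (simp_all add: tau_class_minus minus_vector_matrix_mult)
  qed
  define S where "S = act (comm.cls A 0)"
  have A: "A \<in> commutant A" by (simp add: commutant_def)
  have S: "S (rows.cls v M) = rows.cls (v v* A) M" for v M by (simp add: S_def act_class A)
  have "S \<in> carrier E" unfolding S_def by (rule act_mem) (simp add: carrier_R comm.class_mem A)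
  then have Sf: "S (f (rows.cls v M)) = f (S (rows.cls v M))" for v M
    using continuous_End_commute f by simp
  have "rows.cls (v v* (A ** X)) L = rows.cls (v v* (X ** A)) L" for v
    using Sf[of v 0] by (simp add: S X vector_matrix_mul_assoc)
  then obtain m where m: "A ** X ** mpow A m = X ** A ** mpow A m" using matrices_agree_later by blast
  \<comment> \<open>the stage \<open>L + (L + 2 m)\<close> of \<open>Y\<close> has to be even, since \<open>[Y, K]\<close> raises stages by \<open>2 K\<close>\<close>
  define Y where "Y = X ** mpow A (L + 2 * m)"
  have AA: "A ** mpow A n = mpow A n ** A" for n using mpow_commute[OF A] by simp
  have "A ** Y = A ** X ** mpow A m ** mpow A (m + L)"
    by (simp add: Y_def matrix_mul_assoc[symmetric] mpow_add[symmetric] mult_2 add_ac)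
  also have "\<dots> = X ** A ** (mpow A m ** mpow A (m + L))" unfolding m by (simp only: matrix_mul_assoc)
  also have "\<dots> = Y ** A"
    by (simp add: Y_def matrix_mul_assoc[symmetric] mpow_add[symmetric] AA mult_2 add_ac)
  finally have Y: "Y \<in> commutant A" by (simp add: commutant_def)
  define U where "U = comm.cls Y (L + m)"
  have U: "U \<in> carrier R" by (simp add: U_def carrier_R comm.class_mem Y)
  have agree: "f (rows.cls v M) = act U (rows.cls v M)" for v M
  proof (induction M arbitrary: v)
    case 0
    show ?case
      using class_shift[of "v v* X" "L + 2 * m" L]
      by (simp add: X U_def act_class Y) (simp add: Y_def vector_matrix_mul_assoc mult_2 add_ac)
  next
    case (Suc M)
    have down: "S (rows.cls v (Suc M)) = rows.cls v M"
      using class_shift[of v 1 M] by (simp add: S)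
    have S_inj: "g = h" if gh: "S g = S h" "g \<in> carrier G" "h \<in> carrier G" for g h
    proof -
      obtain u u' J where g: "g = rows.cls u J" "h = rows.cls u' J"
        using gh(2,3,3) unfolding carrier_G by (rule rows.ilim_cases3)
      have up: "rows.cls (u v* A) (Suc J) = rows.cls u J" for u J using class_shift[of u 1 J] by simp
      obtain n where "u v* A v* mpow A n = u' v* A v* mpow A n"
        using gh(1) class_eqD unfolding g S by blast
      then have "rows.cls (u v* A) (Suc J) = rows.cls (u' v* A) (Suc J)" by (metis class_shift)
      then show ?thesis by (simp add: g up)
    qed
    show ?case
    proof (rule S_inj)
      have "S (act U (rows.cls v (Suc M))) = act U (S (rows.cls v (Suc M)))"
        using continuous_End_commute[OF \<open>S \<in> carrier E\<close> act_mem[OF U]] by simp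
      then show "S (f (rows.cls v (Suc M))) = S (act U (rows.cls v (Suc M)))"
        unfolding Sf down by (simp add: Suc.IH)
      show "f (rows.cls v (Suc M)) \<in> carrier G" using f_closed by simp
      show "act U (rows.cls v (Suc M)) \<in> carrier G"
        using act_mem[OF U] by (auto simp: carrier_E hom_def)
    qed
  qed
  have "f = act U"
  proof (rule extensionalityI[of _ "carrier G"])
    show "f \<in> extensional (carrier G)" using f by (simp add: carrier_E)
    show "act U \<in> extensional (carrier G)" by (simp add: act_def)
    show "f g = act U g" if "g \<in> carrier G" for g
      using that agree by (auto elim!: class_cases)
  qed
  then show ?thesis using U by blast
qed

text \<open>The product of \<open>[X, N]\<close> and \<open>[Y, M]\<close> acts by \<open>v \<mapsto> v X Y\<close>, that is, by \<open>[X, N]\<close> first. Commutativity of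
  the continuous endomorphisms brings the composition into the order required in their ring.\<close>

lemma act_ring_hom: "act \<in> ring_hom R E"
proof (rule ring_hom_memI)
  fix U V assume U: "U \<in> carrier R" and V: "V \<in> carrier R"
  obtain X Y N where XY: "X \<in> commutant A" "Y \<in> commutant A" "U = comm.cls X N" "V = comm.cls Y N"
    using U V V unfolding carrier_R by (rule comm.ilim_cases3)
  have UV: "U \<otimes>\<^bsub>R\<^esub> V = comm.cls (X ** Y) (N + N)"
    unfolding XY by (rule homoclinic_mult_class[OF XY(1,2)])
  show "act (U \<otimes>\<^bsub>R\<^esub> V) = act U \<otimes>\<^bsub>E\<^esub> act V"
  proof (rule extensionalityI[of _ "carrier G"])
    show "act (U \<otimes>\<^bsub>R\<^esub> V) \<in> extensional (carrier G)" by (simp add: act_def)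
    show "act U \<otimes>\<^bsub>E\<^esub> act V \<in> extensional (carrier G)" by (simp add: continuous_End_def Let_def)
    fix g assume g: "g \<in> carrier G"
    then obtain v M where v: "g = rows.cls v M" by (rule class_cases)
    have "act (U \<otimes>\<^bsub>R\<^esub> V) g = act V (act U g)"
      unfolding UV v unfolding XY
      by (simp add: act_class XY commutant_mult vector_matrix_mul_assoc algebra_simps)
    also have "\<dots> = act U (act V g)"
      using g by (rule continuous_End_commute[OF act_mem[OF V] act_mem[OF U]])
    finally show "act (U \<otimes>\<^bsub>R\<^esub> V) g = (act U \<otimes>\<^bsub>E\<^esub> act V) g"
      using g by (simp add: continuous_End_def Let_def compose_def)
  qed
  have UV: "U \<oplus>\<^bsub>R\<^esub> V = comm.cls (X + Y) N"
    unfolding XY by (simp add: homoclinic_K0_ring_def Let_def comm.ilim_add_class XY)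
  show "act (U \<oplus>\<^bsub>R\<^esub> V) = act U \<oplus>\<^bsub>E\<^esub> act V"
  proof (rule extensionalityI[of _ "carrier G"])
    show "act (U \<oplus>\<^bsub>R\<^esub> V) \<in> extensional (carrier G)" by (simp add: act_def)
    show "act U \<oplus>\<^bsub>E\<^esub> act V \<in> extensional (carrier G)" by (simp add: continuous_End_def Let_def)
    fix g assume g: "g \<in> carrier G"
    then obtain v M where v: "g = rows.cls v M" by (rule class_cases)
    have "act (U \<oplus>\<^bsub>R\<^esub> V) g = act U g \<otimes>\<^bsub>G\<^esub> act V g"
      unfolding UV v unfolding XY
      by (simp add: act_class XY comm.add_mem vector_matrix_mult_add_rdistrib class_mult)
    then show "act (U \<oplus>\<^bsub>R\<^esub> V) g = (act U \<oplus>\<^bsub>E\<^esub> act V) g"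
      using g by (simp add: continuous_End_def Let_def)
  qed
next
  show "act \<one>\<^bsub>R\<^esub> = \<one>\<^bsub>E\<^esub>"
  proof (rule extensionalityI[of _ "carrier G"])
    show "act \<one>\<^bsub>R\<^esub> \<in> extensional (carrier G)" by (simp add: act_def)
    show "\<one>\<^bsub>E\<^esub> \<in> extensional (carrier G)" by (simp add: continuous_End_def Let_def)
    fix g assume g: "g \<in> carrier G"
    then obtain v M where v: "g = rows.cls v M" by (rule class_cases)
    have "mat 1 \<in> commutant A" by (simp add: commutant_def)
    then show "act \<one>\<^bsub>R\<^esub> g = \<one>\<^bsub>E\<^esub> g"
      using g by (simp add: homoclinic_K0_ring_def continuous_End_def Let_def v act_class)
  qed
qed (rule act_mem)

lemma act_ring_iso: "act \<in> ring_iso R E"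
proof -
  have "act ` carrier R = carrier E" using act_mem act_surj by blast
  then show ?thesis using act_ring_hom act_inj by (simp add: ring_iso_def bij_betw_def)
qed

end

theorem corollary1p7:
  fixes A :: "int ^ 'n ^ 'n"
    and P :: "(int \<Rightarrow> 'n edge) set"
    and \<theta> :: "((int ^ 'n) \<times> nat) set \<Rightarrow> real ^ 'k"
  assumes "primitive_matrix A"
    and "P \<subseteq> edge_shift A" and "finite P" and "P \<noteq> {}" and "left_shift ` P = P"
    and "order_embedding (dimension_group A) \<theta>"
    and "closure (\<theta> ` carrier (dimension_group A)) = UNIV"
  shows "homoclinic_K0_ring A \<simeq> continuous_End (dimension_group A) \<theta>"
proof -
  interpret dense_dimension_group A \<theta>
    using assms by (simp add: dense_dimension_group_def)
  show ?thesis using act_ring_iso by (auto simp: is_ring_iso_def)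
qed

end
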